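(* Let $G$ be a chordal graph. Then $G$ admits an $M_1$-partition if and only if $G$ is $\mathcal{F}$-free, where $\mathcal{F} = \{F_1, F_2, F_3, F_4, F_5, F_6, F_7\} \cup \mathcal{F}_1$. That is: $V_G$ can be partitioned into three (possibly empty) independent sets $V_1, V_2, V_3$ such that every vertex of $V_2$ is adjacent to every vertex of $V_3$, if and only if no member of $\mathcal{F}$ is an induced subgraph of $G$.
   Context: All graphs are finite, simple and undirected. A graph is chordal if every induced cycle in it has length $3$. For a set $\mathcal{S}$ of graphs, a graph is $\mathcal{S}$-free if it contains no member of $\mathcal{S}$ as an induced subgraph (up to isomorphism). For a symmetric $m\times m$ matrix $M$ over $\{0,1,\ast\}$, an $M$-partition of a graph $G$ is a partition $(V_1,\dots,V_m)$ of $V_G$ (parts may be empty) such that, for all $i,j$ (including $i=j$), any two distinct vertices $x \in V_i$, $y\in V_j$ are adjacent if $M_{ij}=1$, non-adjacent if $M_{ij}=0$, with no restriction if $M_{ij}=\ast$. Here $$M_1 = \begin{pmatrix} 0 & \ast & \ast \\ \ast & 0 & 1 \\ \ast & 1 & 0\end{pmatrix}.$$ The graphs in $\mathcal{F}$ are as follows. - $F_1$ is the disjoint union $K_3 + K_2$ of a triangle and an edge. - $F_2$ is the net: a triangle with one pendant vertex attached to each of its three vertices (6 vertices, 6 edges). - $F_3$ is a triangle $v_0v_1v_2$ with a pendant path of length $2$ attached at $v_1$ and another at $v_2$: vertices $v_0,v_1,v_2,a,b,c,d$ and edges $v_0v_1, v_0v_2, v_1v_2, v_1a, ab, v_2c,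 cd$. - $F_4$ has vertices $v_0,\dots,v_6$ and edges $v_0v_1, v_0v_2, v_0v_5, v_0v_6, v_1v_2, v_1v_6, v_2v_5, v_1v_3, v_2v_4$. - $F_5$ is the 3-sun: vertices $1,\dots,6$ and edges $12,23,34,45,56,61,24,46,26$. - $F_6$ is the square of the path on six vertices: vertices $p_1,\dots,p_6$ with $p_i p_j$ an edge if and only if $1 \le |i-j|\le 2$. - $F_7$ is $K_4$. - $\mathcal{F}_1$ is the infinite family of graphs consisting, for each odd $k \ge 5$, of a path $p_0p_1\cdots p_k$ (with $k$ edges) together with an additional vertex $x$ adjacent to exactly $p_1,\dots,p_{k-1}$. *)

theory Defs
  imports
    "Graph_Theory.Pair_Digraph"
    "Graph_Theory.Digraph_Component"
    "Graph_Theory.Digraph_Isomorphism"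
    "Jordan_Normal_Form.Matrix"
    "HOL-Library.Disjoint_Sets"
begin

text \<open>
  Finite simple undirected graphs are the symmetric, loop-free, finite digraphs of
  the locale \<^locale>\<open>pair_graph\<close>: an edge is represented by its two arcs.
\<close>

definition ugraph :: "'a set \<Rightarrow> ('a \<times> 'a) set \<Rightarrow> 'a pair_pre_digraph" where
  "ugraph V E = \<lparr> pverts = V, parcs = E \<union> E\<inverse> \<rparr>"

lemma ugraph_simps [simp]:
  "pverts (ugraph V E) = V"
  "parcs (ugraph V E) = E \<union> E\<inverse>"
  by (simp_all add: ugraph_def)

lemma pair_graph_ugraph:
  assumes "finite V" "E \<subseteq> V \<times> V" "irrefl E"
  shows "pair_graph (ugraph V E)"
proof -
  have "finite E"
    using assms by (meson finite_SigmaI finite_subset)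
  with assms show ?thesis
    by unfold_locales (auto simp: symmetric_def sym_def irrefl_def)
qed


subsection \<open>Induced subgraphs and chordality\<close>

definition contains_induced :: "'a pair_pre_digraph \<Rightarrow> 'b pair_pre_digraph \<Rightarrow> bool" where
  "contains_induced G F \<longleftrightarrow>
     (\<exists>H. induced_subgraph H (with_proj G) \<and> digraph_iso (with_proj F) H)"

definition free_of :: "'b pair_pre_digraph set \<Rightarrow> 'a pair_pre_digraph \<Rightarrow> bool" where
  "free_of S G \<longleftrightarrow> (\<forall>F\<in>S. \<not> contains_induced G F)"

definition cycle_graph :: "nat \<Rightarrow> nat pair_pre_digraph" where
  "cycle_graph n = ugraph {0..<n} {(i, Suc i mod n) | i. i < n}"

definition chordal :: "'a pair_pre_digraph \<Rightarrow> bool" where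
  "chordal G \<longleftrightarrow> (\<forall>n\<ge>3. contains_induced G (cycle_graph n) \<longrightarrow> n = 3)"


subsection \<open>Matrix partitions\<close>

datatype pentry = NonAdj (\<open>\<^bold>0\<close>) | Adj (\<open>\<^bold>1\<close>) | Any (\<open>\<^bold>*\<close>)

text \<open>
  The parts are indexed from 0 and may be empty. The matrix is meant to be square
  and symmetric.
\<close>

definition matrix_partition ::
    "pentry mat \<Rightarrow> 'a pair_pre_digraph \<Rightarrow> (nat \<Rightarrow> 'a set) \<Rightarrow> bool" where
  "matrix_partition M G P \<longleftrightarrow>
     (\<Union>i<dim_row M. P i) = pverts G \<and>
     disjoint_family_on P {..<dim_row M} \<and>
     (\<forall>i<dim_row M. \<forall>j<dim_row M. \<forall>x\<in>P i. \<forall>y\<in>P j. x \<noteq> y \<longrightarrow>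
        (M $$ (i, j) = \<^bold>1 \<longrightarrow> (x, y) \<in> parcs G) \<and>
        (M $$ (i, j) = \<^bold>0 \<longrightarrow> (x, y) \<notin> parcs G))"

definition admits_partition :: "pentry mat \<Rightarrow> 'a pair_pre_digraph \<Rightarrow> bool" where
  "admits_partition M G \<longleftrightarrow> (\<exists>P. matrix_partition M G P)"

definition M1 :: "pentry mat" where
  "M1 = mat_of_rows_list 3
     [[\<^bold>0, \<^bold>*, \<^bold>*],
      [\<^bold>*, \<^bold>0, \<^bold>1],
      [\<^bold>*, \<^bold>1, \<^bold>0]]"

lemma M1_carrier: "M1 \<in> carrier_mat 3 3"
  by (rule carrier_matI) (simp_all add: M1_def mat_of_rows_list_def)

lemma M1_symmetric: "transpose_mat M1 = M1"
  by (rule eq_matI)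
     (auto simp: M1_def mat_of_rows_list_def less_Suc_eq numeral_3_eq_3)

definition independent_set :: "'a pair_pre_digraph \<Rightarrow> 'a set \<Rightarrow> bool" where
  "independent_set G A \<longleftrightarrow> (\<forall>x\<in>A. \<forall>y\<in>A. (x, y) \<notin> parcs G)"

lemma admits_partition_M1_iff:
  assumes "pair_graph G"
  shows "admits_partition M1 G \<longleftrightarrow>
    (\<exists>V1 V2 V3. V1 \<union> V2 \<union> V3 = pverts G \<and>
       V1 \<inter> V2 = {} \<and> V1 \<inter> V3 = {} \<and> V2 \<inter> V3 = {} \<and>
       independent_set G V1 \<and> independent_set G V2 \<and> independent_set G V3 \<and>
       (\<forall>x\<in>V2. \<forall>y\<in>V3. (x, y) \<in> parcs G))"
    (is "?L \<longleftrightarrow> ?R")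
proof -
  interpret pair_graph G by fact
  have irr: "(x, x) \<notin> parcs G" for x
    using pair_no_loops by fastforce
  have sy: "(y, x) \<in> parcs G" if "(x, y) \<in> parcs G" for x y
    using pair_sym_arcs that by (auto simp: symmetric_def dest: symD)
  have lt3: "{..<3::nat} = {0, 1, 2}" by auto
  have all3: "(\<forall>i<3::nat. Q i) \<longleftrightarrow> Q 0 \<and> Q 1 \<and> Q 2" for Q
    by (auto simp: less_Suc_eq numeral_3_eq_3 numeral_2_eq_2)
  have dim: "dim_row M1 = 3" using M1_carrier by auto
  have ent: "M1 $$ (0,0) = \<^bold>0" "M1 $$ (0,1) = \<^bold>*" "M1 $$ (0,2) = \<^bold>*"
            "M1 $$ (1,0) = \<^bold>*" "M1 $$ (1,1) = \<^bold>0" "M1 $$ (1,2) = \<^bold>1"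
            "M1 $$ (2,0) = \<^bold>*" "M1 $$ (2,1) = \<^bold>1" "M1 $$ (2,2) = \<^bold>0"
    by (simp_all add: M1_def mat_of_rows_list_def)
  have key: "matrix_partition M1 G P \<longleftrightarrow>
      P 0 \<union> P 1 \<union> P 2 = pverts G \<and> P 0 \<inter> P 1 = {} \<and> P 0 \<inter> P 2 = {} \<and> P 1 \<inter> P 2 = {} \<and>
      independent_set G (P 0) \<and> independent_set G (P 1) \<and> independent_set G (P 2) \<and>
      (\<forall>x\<in>P 1. \<forall>y\<in>P 2. (x, y) \<in> parcs G)" for P
  proof -
    have U: "(\<Union>i<3. P i) = P 0 \<union> P 1 \<union> P 2"
      unfolding lt3 by auto
    have D: "disjoint_family_on P {..<3} \<longleftrightarrow>
        P 0 \<inter> P 1 = {} \<and> P 0 \<inter> P 2 = {} \<and> P 1 \<inter> P 2 = {}"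
      unfolding lt3 disjoint_family_on_def by auto
    have I: "(\<forall>x\<in>A. \<forall>y\<in>A. x \<noteq> y \<longrightarrow> (x, y) \<notin> parcs G) \<longleftrightarrow> independent_set G A" for A
      unfolding independent_set_def using irr by metis
    have S: "(\<forall>x\<in>P 1. \<forall>y\<in>P 2. x \<noteq> y \<longrightarrow> (x, y) \<in> parcs G) \<longleftrightarrow>
        (\<forall>x\<in>P 1. \<forall>y\<in>P 2. (x, y) \<in> parcs G)" if "P 1 \<inter> P 2 = {}"
    proof (intro ball_cong refl)
      fix x y assume "x \<in> P 1" "y \<in> P 2"
      with that have "x \<noteq> y" by auto
      then show "(x \<noteq> y \<longrightarrow> (x, y) \<in> parcs G) \<longleftrightarrow> (x, y) \<in> parcs G" by simp
    qed
    have T: "(\<forall>x\<in>P 2. \<forall>y\<in>P 1. x \<noteq> y \<longrightarrow> (x, y) \<in> parcs G) \<longleftrightarrow>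
        (\<forall>x\<in>P 1. \<forall>y\<in>P 2. x \<noteq> y \<longrightarrow> (x, y) \<in> parcs G)"
      by (intro iffI ballI impI; rule sy) simp_all
    have neq: "\<^bold>0 \<noteq> \<^bold>1" "\<^bold>1 \<noteq> \<^bold>0" "\<^bold>* \<noteq> \<^bold>0" "\<^bold>* \<noteq> \<^bold>1" by simp_all
    show ?thesis
      unfolding matrix_partition_def dim all3 ent U D
      by (cases "P 1 \<inter> P 2 = {}") (simp_all add: neq I S T conj_ac del: One_nat_def)
  qed
  show ?thesis
  proof
    assume ?L
    then show ?R unfolding admits_partition_def key by blast
  next
    assume ?R
    then obtain V1 V2 V3 where "matrix_partition M1 G (\<lambda>i. if i = 0 then V1 else if i = 1 then V2 else V3)"
      unfolding key by auto
    then show ?L unfolding admits_partition_def by blast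
  qed
qed


subsection \<open>The forbidden graphs\<close>

definition F1 :: "nat pair_pre_digraph" where
  "F1 = ugraph {0..4} {(0,1), (0,2), (1,2), (3,4)}"

definition F2 :: "nat pair_pre_digraph" where
  "F2 = ugraph {0..5} {(0,1), (0,2), (1,2), (0,3), (1,4), (2,5)}"

text \<open>The pendant paths of \<open>F3\<close> are 1, 3, 4 and 2, 5, 6.\<close>

definition F3 :: "nat pair_pre_digraph" where
  "F3 = ugraph {0..6} {(0,1), (0,2), (1,2), (1,3), (3,4), (2,5), (5,6)}"

definition F4 :: "nat pair_pre_digraph" where
  "F4 = ugraph {0..6}
     {(0,1), (0,2), (0,5), (0,6), (1,2), (1,6), (2,5), (1,3), (2,4)}"

definition F5 :: "nat pair_pre_digraph" where
  "F5 = ugraph {1..6}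
     {(1,2), (2,3), (3,4), (4,5), (5,6), (6,1), (2,4), (4,6), (2,6)}"

definition F6 :: "nat pair_pre_digraph" where
  "F6 = ugraph {1..6} {(i,j) \<in> {1..6} \<times> {1..6}. i < j \<and> j - i \<le> 2}"

definition F7 :: "nat pair_pre_digraph" where
  "F7 = ugraph {0..3} {(i,j) \<in> {0..3} \<times> {0..3}. i \<noteq> j}"

text \<open>The path is 0, 1, ..., \<open>k\<close>; the additional vertex is \<open>Suc k\<close>.\<close>

definition fan :: "nat \<Rightarrow> nat pair_pre_digraph" where
  "fan k = ugraph {0..Suc k}
     ({(i, Suc i) | i. i < k} \<union> {(Suc k, i) | i. 1 \<le> i \<and> i \<le> k - 1})"

definition forbidden :: "nat pair_pre_digraph set" where
  "forbidden = {F1, F2, F3, F4, F5, F6, F7} \<union> {fan k | k. odd k \<and> 5 \<le> k}"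

lemma pair_graph_forbidden: "F \<in> forbidden \<Longrightarrow> pair_graph F"
  unfolding forbidden_def F1_def F2_def F3_def F4_def F5_def F6_def F7_def fan_def
  by (elim UnE insertE emptyE CollectE exE conjE;
      simp only:; rule pair_graph_ugraph; force simp: irrefl_def)

lemma pair_graph_cycle_graph: "3 \<le> n \<Longrightarrow> pair_graph (cycle_graph n)"
  unfolding cycle_graph_def
  by (auto intro!: pair_graph_ugraph simp: irrefl_def mod_Suc)

lemma contains_induced_iff:
  assumes "pair_graph G" "pair_graph F"
  shows "contains_induced G F \<longleftrightarrow>
    (\<exists>f. inj_on f (pverts F) \<and> f ` pverts F \<subseteq> pverts G \<and>
       (\<forall>x\<in>pverts F. \<forall>y\<in>pverts F. (f x, f y) \<in> parcs G \<longleftrightarrow> (x, y) \<in> parcs F))"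
    (is "?L \<longleftrightarrow> ?R")
proof -
  interpret G: pair_graph G by fact
  interpret F: pair_graph F by fact
  have wfG: "wf_digraph (with_proj G)" and wfF: "wf_digraph (with_proj F)"
    by unfold_locales
  show ?thesis
  proof
    assume ?L
    then obtain H h where H: "induced_subgraph H (with_proj G)"
      and h: "pre_digraph.digraph_isomorphism (with_proj F) h" "H = app_iso h (with_proj F)"
      unfolding contains_induced_def digraph_iso_def by blast
    have inj: "inj_on (iso_verts h) (pverts F)"
      and ends: "\<And>a. a \<in> parcs F \<Longrightarrow> iso_verts h (fst a) = iso_tail h (iso_arcs h a) \<and>
                  iso_verts h (snd a) = iso_head h (iso_arcs h a)"
      using h(1) by (auto simp: pre_digraph.digraph_isomorphism_def)
    have th: "iso_tail h = fst" "iso_head h = snd"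
      using H h(2) by (auto simp: induced_subgraph_def subgraph_def compatible_def)
    have arc: "iso_arcs h a = (iso_verts h (fst a), iso_verts h (snd a))" if "a \<in> parcs F" for a
      using ends[OF that] th by (simp add: prod_eq_iff)
    have vs: "iso_verts h ` pverts F \<subseteq> pverts G"
      and as: "iso_arcs h ` parcs F =
          {e \<in> parcs G. fst e \<in> iso_verts h ` pverts F \<and> snd e \<in> iso_verts h ` pverts F}"
      using H h(2) by (auto simp: induced_subgraph_def subgraph_def)
    have "(iso_verts h x, iso_verts h y) \<in> parcs G \<longleftrightarrow> (x, y) \<in> parcs F"
      if xy: "x \<in> pverts F" "y \<in> pverts F" for x y
    proof
      assume "(iso_verts h x, iso_verts h y) \<in> parcs G"
      then have "(iso_verts h x, iso_verts h y) \<in> iso_arcs h ` parcs F"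
        using as xy by auto
      then obtain u v where uv: "(u, v) \<in> parcs F"
        "iso_verts h x = iso_verts h u" "iso_verts h y = iso_verts h v"
        using arc by force
      then have "u = x" "v = y"
        using inj xy F.in_arcsD1 F.in_arcsD2 by (metis inj_onD)+
      with uv show "(x, y) \<in> parcs F" by simp
    next
      assume "(x, y) \<in> parcs F"
      then show "(iso_verts h x, iso_verts h y) \<in> parcs G"
        using as arc by (metis (mono_tags, lifting) fst_conv image_eqI mem_Collect_eq snd_conv)
    qed
    with inj vs show ?R by blast
  next
    assume ?R
    then obtain f where inj: "inj_on f (pverts F)" and vs: "f ` pverts F \<subseteq> pverts G"
      and adj: "\<And>x y. x \<in> pverts F \<Longrightarrow> y \<in> pverts F \<Longrightarrow> (f x, f y) \<in> parcs G \<longleftrightarrow> (x, y) \<in> parcs F"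
      by blast
    define h where "h = \<lparr> iso_verts = f, iso_arcs = map_prod f f, iso_head = snd, iso_tail = fst \<rparr>"
    have sub: "parcs F \<subseteq> pverts F \<times> pverts F"
      using F.in_arcsD1 F.in_arcsD2 by auto
    have "inj_on (map_prod f f) (parcs F)"
      using inj_on_subset[OF map_prod_inj_on[OF inj inj] sub] .
    then have iso: "pre_digraph.digraph_isomorphism (with_proj F) h"
      using wfF inj by (auto simp: pre_digraph.digraph_isomorphism_def h_def)
    have as: "map_prod f f ` parcs F = {e \<in> parcs G. fst e \<in> f ` pverts F \<and> snd e \<in> f ` pverts F}"
    proof (intro equalityI subsetI)
      fix e assume "e \<in> map_prod f f ` parcs F"
      then obtain x y where "(x, y) \<in> parcs F" "e = (f x, f y)" by auto
      moreover from this have "x \<in> pverts F" "y \<in> pverts F" using sub by auto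
      ultimately show "e \<in> {e \<in> parcs G. fst e \<in> f ` pverts F \<and> snd e \<in> f ` pverts F}"
        using adj by simp
    next
      fix e assume "e \<in> {e \<in> parcs G. fst e \<in> f ` pverts F \<and> snd e \<in> f ` pverts F}"
      then obtain x y where "x \<in> pverts F" "y \<in> pverts F" "e = (f x, f y)" "(f x, f y) \<in> parcs G"
        by (cases e) auto
      with adj have "(x, y) \<in> parcs F" by blast
      with \<open>e = (f x, f y)\<close> show "e \<in> map_prod f f ` parcs F" by force
    qed
    have wfH: "wf_digraph (app_iso h (with_proj F))"
      by (rule F.wf_digraphI_app_iso[OF iso])
    have "induced_subgraph (app_iso h (with_proj F)) (with_proj G)"
      unfolding induced_subgraph_def subgraph_def compatible_def
      using wfG wfH vs as by (auto simp: h_def)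
    with iso show ?L unfolding contains_induced_def digraph_iso_def by blast
  qed
qed

end

theory Submission
  imports Defs
begin

text \<open>
  In a chordal graph the join of \<open>V2\<close> and \<open>V3\<close> contains no 4-cycle, so one of the two sets has at
  most one vertex. Hence a non-bipartite chordal graph has an \<open>M1\<close>-partition iff some vertex \<open>c\<close>
  lies in every triangle and \<open>G - c\<close> has a 2-colouring in which all non-neighbours of \<open>c\<close> get the same
  colour, i.e. \<open>G - c\<close> has no odd walk between non-neighbours of \<open>c\<close>. A shortest such walk is an edge,
  or the base of a bull with nose \<open>c\<close>, or yields a member of the infinite family.

  If \<open>G\<close> is free of the forbidden graphs, its triangles have a common vertex (otherwise \<open>F5\<close>, \<open>F6\<close> or
  \<open>F7\<close> occurs). If such a vertex \<open>x\<close> does not work as \<open>c\<close>, the edge or bull witnessing this singles out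
  a second common vertex adjacent to \<open>x\<close>, its partner. If no common vertex works, following partners
  leads to a cycle of length 2 or 3 in some triangle, and the witnesses along it form \<open>F2\<close> or \<open>F3\<close>.
  Only \<open>F1\<close> and the chordality are needed to find the partner of an edge, \<open>F2\<close> and \<open>F4\<close> for a bull.
\<close>

section \<open>Finite graphs and embeddings of patterns\<close>

lemma forbidden_members:
  "F1 \<in> forbidden" "F2 \<in> forbidden" "F3 \<in> forbidden" "F4 \<in> forbidden"
  "F5 \<in> forbidden" "F6 \<in> forbidden" "F7 \<in> forbidden"
  "odd k \<Longrightarrow> 5 \<le> k \<Longrightarrow> fan k \<in> forbidden"
  by (auto simp: forbidden_def)

lemma small_intervals:
  "{0..3::nat} = {0, 1, 2, 3}" "{0..4::nat} = {0, 1, 2, 3, 4}"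
  "{0..5::nat} = {0, 1, 2, 3, 4, 5}" "{0..6::nat} = {0, 1, 2, 3, 4, 5, 6}"
  "{Suc 0..6} = {1, 2, 3, 4, 5, 6}"
  by auto

locale sgraph = pair_graph G for G :: "'a pair_pre_digraph"
begin

abbreviation adj (infix "\<sim>" 50) where "x \<sim> y \<equiv> (x, y) \<in> parcs G"

lemma adj_sym: "x \<sim> y \<longleftrightarrow> y \<sim> x"
  using pair_sym_arcs by (auto simp: symmetric_def dest: symD)

lemma adj_irrefl [simp]: "\<not> x \<sim> x"
  using pair_no_loops by fastforce

lemma adj_verts: "x \<sim> y \<Longrightarrow> x \<in> pverts G \<and> y \<in> pverts G"
  using in_arcsD1 in_arcsD2 by fastforce

text \<open>
  A map that preserves and reflects adjacency is injective as soon as no two vertices of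
  the pattern have the same neighbourhood.
\<close>

lemma contains_inducedI:
  fixes F :: "'b::linorder pair_pre_digraph"
  assumes F: "pair_graph F"
    and adj: "\<forall>x\<in>pverts F. \<forall>y\<in>pverts F. x < y \<longrightarrow> (f x \<sim> f y \<longleftrightarrow> (x, y) \<in> parcs F)"
    and nbr: "\<forall>x\<in>pverts F. \<exists>z\<in>pverts F. (x, z) \<in> parcs F"
    and twin: "\<forall>x\<in>pverts F. \<forall>y\<in>pverts F. x < y \<longrightarrow>
      (\<exists>z\<in>pverts F. (x, z) \<in> parcs F \<longleftrightarrow> (y, z) \<notin> parcs F)"
  shows "contains_induced G F"
proof -
  interpret F: sgraph F using F by (rule sgraph.intro)
  have adj': "f x \<sim> f y \<longleftrightarrow> (x, y) \<in> parcs F" if "x \<in> pverts F" "y \<in> pverts F" for x y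
  proof (cases x y rule: linorder_cases)
    case less
    with adj that show ?thesis by blast
  next
    case greater
    with adj that have "f y \<sim> f x \<longleftrightarrow> (y, x) \<in> parcs F" by blast
    then show ?thesis by (simp only: adj_sym[of "f x"] F.adj_sym[of x])
  qed simp
  have neq: "f x \<noteq> f y" if xy: "x \<in> pverts F" "y \<in> pverts F" "x < y" for x y
  proof -
    obtain z where "z \<in> pverts F" "(x, z) \<in> parcs F \<longleftrightarrow> (y, z) \<notin> parcs F"
      using twin xy by blast
    then show ?thesis using adj' xy by metis
  qed
  have "x = y" if "x \<in> pverts F" "y \<in> pverts F" "f x = f y" for x y
    using neq[of x y] neq[of y x] that by (cases x y rule: linorder_cases) auto
  then have "inj_on f (pverts F)" by (rule inj_onI)
  moreover have "f ` pverts F \<subseteq> pverts G"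
    using adj' nbr adj_verts by blast
  ultimately show ?thesis
    using contains_induced_iff[OF _ F] adj' pair_graph_axioms by blast
qed

end

subsection \<open>Walks and 2-colourings\<close>

lemma walk_segment:
  assumes "\<forall>i<n. (p i, p (Suc i)) \<in> R" "i \<le> j" "j \<le> n"
  shows "(p i, p j) \<in> R ^^ (j - i)"
  using assms(2,3)
proof (induction j rule: dec_induct)
  case (step m)
  then show ?case using assms(1) by (auto simp: Suc_diff_le)
qed simp

lemma relpow_trans: "(x, y) \<in> R ^^ m \<Longrightarrow> (y, z) \<in> R ^^ n \<Longrightarrow> (x, z) \<in> R ^^ (m + n)"
  by (auto simp: relpow_add)

lemma relpow_sym: "sym R \<Longrightarrow> (x, y) \<in> R ^^ n \<Longrightarrow> (y, x) \<in> R ^^ n"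
proof (induction n arbitrary: y)
  case (Suc n)
  then obtain z where "(x, z) \<in> R ^^ n" "(z, y) \<in> R" by auto
  with Suc show ?case by (metis relpow_Suc_I2 symD)
qed simp

text \<open>Colour by the parity of a walk from a root of the component; without odd closed walks
  the parity does not depend on the walk. Taking the root in \<open>S\<close> whenever the component
  meets \<open>S\<close> puts all of \<open>S\<close> on the even side.\<close>

lemma two_colouring_extending:
  assumes R: "sym R"
    and closed: "\<And>x n. odd n \<Longrightarrow> (x, x) \<notin> R ^^ n"
    and between: "\<And>x y n. odd n \<Longrightarrow> x \<in> S \<Longrightarrow> y \<in> S \<Longrightarrow> (x, y) \<notin> R ^^ n"
  shows "\<exists>A. S \<subseteq> A \<and> (\<forall>(x, y) \<in> R. x \<in> A \<longleftrightarrow> y \<notin> A)"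
proof -
  \<comment> \<open>Candidate roots for the component of \<open>v\<close>: if \<open>S\<close> meets
    that component, only vertices of \<open>S\<close> qualify.\<close>
  define root where
    "root v x \<longleftrightarrow> (x, v) \<in> R\<^sup>* \<and> (x \<in> S \<or> (\<forall>s\<in>S. (s, v) \<notin> R\<^sup>*))" for v x
  define r where "r v = (SOME x. root v x)" for v
  have "\<exists>x. root v x" for v
    unfolding root_def by blast
  then have root: "root v (r v)" for v
    unfolding r_def by (rule someI_ex)
  have reach: "\<exists>n. (r v, v) \<in> R ^^ n" for v
    using root[of v] by (auto simp: root_def dest: rtrancl_imp_relpow)
  have r_eq: "r x = r y" if "(x, y) \<in> R" for x y
  proof -
    \<comment> \<open>Adjacent vertices have the same predicate \<open>root\<close>, so
      \<open>SOME\<close> selects the same root for both.\<close>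
    have "(z, x) \<in> R\<^sup>* \<longleftrightarrow> (z, y) \<in> R\<^sup>*" for z
      using that R by (meson rtrancl.rtrancl_into_rtrancl symD)
    then have "root x = root y" by (auto simp: root_def fun_eq_iff)
    then show ?thesis by (simp add: r_def)
  qed
  define A where "A = {v. \<exists>n. even n \<and> (r v, v) \<in> R ^^ n}"
  have "S \<subseteq> A"
  proof
    fix s assume s: "s \<in> S"
    have "r s \<in> S" using root[of s] s by (auto simp: root_def)
    moreover obtain n where n: "(r s, s) \<in> R ^^ n" using reach by blast
    ultimately have "even n" using between s by blast
    with n show "s \<in> A" by (auto simp: A_def)
  qed
  moreover have "x \<in> A \<longleftrightarrow> y \<notin> A" if xy: "(x, y) \<in> R" for x y
  proof -
    have odd: "odd (m + n)" if "(r x, x) \<in> R ^^ m" "(r y, y) \<in> R ^^ n" for m n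
    proof -
      \<comment> \<open>From the common root to \<open>x\<close>, along the edge to \<open>y\<close>
        and back to the root is a closed walk, hence even.\<close>
      have "(r y, y) \<in> R ^^ Suc m" using that xy r_eq[OF xy] by auto
      then have "(r y, r y) \<in> R ^^ (Suc m + n)"
        using that(2) relpow_trans relpow_sym[OF R] by metis
      with closed have "even (Suc m + n)" by blast
      then show ?thesis by simp
    qed
    obtain m n where m: "(r x, x) \<in> R ^^ m" and n: "(r y, y) \<in> R ^^ n"
      using reach by blast
    show ?thesis
    proof (cases "even m")
      case True
      then have "x \<in> A" using m by (auto simp: A_def)
      moreover have "y \<notin> A" using odd[OF m] True by (auto simp: A_def)
      ultimately show ?thesis by simp
    next
      case False
      then have "even n" using odd[OF m n] by simp
      then have "y \<in> A" using n by (auto simp: A_def)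
      moreover have "x \<notin> A" using odd[OF _ n] \<open>even n\<close> by (auto simp: A_def)
      ultimately show ?thesis by simp
    qed
  qed
  ultimately show ?thesis by blast
qed

subsection \<open>Excluded configurations\<close>

locale chordal_forbidden_free = sgraph +
  assumes chordal: "chordal G" and free: "free_of forbidden G"
begin

lemma no_cycle:
  assumes "4 \<le> n"
    and inj: "inj_on f {0..<n}"
    and adj: "\<And>i j. i < j \<Longrightarrow> j < n \<Longrightarrow> f i \<sim> f j \<longleftrightarrow> j = Suc i \<or> i = 0 \<and> Suc j = n"
  shows False
proof -
  have C: "pair_graph (cycle_graph n)" using assms pair_graph_cycle_graph by simp
  have arcs: "f i \<sim> f j \<longleftrightarrow> (i, j) \<in> parcs (cycle_graph n)" if "i < n" "j < n" "i < j" for i j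
    using that assms by (auto simp: cycle_graph_def mod_Suc split: if_splits)
  have arcs': "f i \<sim> f j \<longleftrightarrow> (i, j) \<in> parcs (cycle_graph n)" if "i < n" "j < n" for i j
  proof -
    have "(i, j) \<in> parcs (cycle_graph n) \<longleftrightarrow> (j, i) \<in> parcs (cycle_graph n)"
      by (auto simp: cycle_graph_def)
    moreover have "(i, i) \<notin> parcs (cycle_graph n)"
      using assms that by (auto simp: cycle_graph_def mod_Suc split: if_splits)
    ultimately show ?thesis
      using arcs[of i j] arcs[of j i] that adj_sym by (metis adj_irrefl nat_neq_iff)
  qed
  have "f ` {0..<n} \<subseteq> pverts G"
  proof clarsimp
    fix i assume i: "i < n"
    have "(i, Suc i mod n) \<in> parcs (cycle_graph n)" "Suc i mod n < n"
      using i by (auto simp: cycle_graph_def)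
    with i show "f i \<in> pverts G" using arcs' adj_verts by blast
  qed
  with inj arcs' have "contains_induced G (cycle_graph n)"
    unfolding contains_induced_iff[OF pair_graph_axioms C]
    by (intro exI[of _ f]) (auto simp: cycle_graph_def)
  then have "n = 3" using chordal assms(1) by (simp add: chordal_def)
  with assms(1) show False by simp
qed

text \<open>Opposite vertices of a 4-cycle have the same neighbours, so their distinctness has to be
  assumed; for the longer cycles below it follows from the adjacencies.\<close>

lemma no_C4:
  assumes "a \<sim> b" "b \<sim> c" "c \<sim> d" "a \<sim> d" "\<not> a \<sim> c" "\<not> b \<sim> d" "a \<noteq> c" "b \<noteq> d"
  shows False
proof (rule no_cycle[of 4 "(!) [a, b, c, d]"])
  have "distinct [a, b, c, d]" using assms by auto
  then show "inj_on ((!) [a, b, c, d]) {0..<4}" by (simp add: inj_on_nth)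
  show "[a, b, c, d] ! i \<sim> [a, b, c, d] ! j \<longleftrightarrow> j = Suc i \<or> i = 0 \<and> Suc j = 4"
    if "i < j" "j < 4" for i j
    using that by (auto simp: less_Suc_eq numeral_eq_Suc assms)
qed simp

lemma no_C5:
  assumes "a \<sim> b" "b \<sim> c" "c \<sim> d" "d \<sim> e" "a \<sim> e"
    "\<not> a \<sim> c" "\<not> a \<sim> d" "\<not> b \<sim> d" "\<not> b \<sim> e" "\<not> c \<sim> e"
  shows False
proof (rule no_cycle[of 5 "(!) [a, b, c, d, e]"])
  have "distinct [a, b, c, d, e]"
    unfolding distinct.simps list.set using assms adj_sym adj_irrefl by blast
  then show "inj_on ((!) [a, b, c, d, e]) {0..<5}" by (simp add: inj_on_nth)
  show "[a, b, c, d, e] ! i \<sim> [a, b, c, d, e] ! j \<longleftrightarrow> j = Suc i \<or> i = 0 \<and> Suc j = 5"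
    if "i < j" "j < 5" for i j
    using that by (auto simp: less_Suc_eq numeral_eq_Suc assms)
qed simp

lemma no_C6:
  assumes "a \<sim> b" "b \<sim> c" "c \<sim> d" "d \<sim> e" "e \<sim> f" "a \<sim> f"
    "\<not> a \<sim> c" "\<not> a \<sim> d" "\<not> a \<sim> e" "\<not> b \<sim> d" "\<not> b \<sim> e" "\<not> b \<sim> f" "\<not> c \<sim> e" "\<not> c \<sim> f" "\<not> d \<sim> f"
  shows False
proof (rule no_cycle[of 6 "(!) [a, b, c, d, e, f]"])
  have "distinct [a, b, c, d, e, f]"
    unfolding distinct.simps list.set using assms adj_sym adj_irrefl by blast
  then show "inj_on ((!) [a, b, c, d, e, f]) {0..<6}" by (simp add: inj_on_nth)
  show "[a, b, c, d, e, f] ! i \<sim> [a, b, c, d, e, f] ! j \<longleftrightarrow> j = Suc i \<or> i = 0 \<and> Suc j = 6"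
    if "i < j" "j < 6" for i j
    using that by (auto simp: less_Suc_eq numeral_eq_Suc assms)
qed simp

lemma no_forbidden:
  assumes "F \<in> forbidden"
    and "\<forall>x\<in>pverts F. \<exists>z\<in>pverts F. (x, z) \<in> parcs F"
    and "\<forall>x\<in>pverts F. \<forall>y\<in>pverts F. x < y \<longrightarrow>
      (\<exists>z\<in>pverts F. (x, z) \<in> parcs F \<longleftrightarrow> (y, z) \<notin> parcs F)"
    and "\<forall>x\<in>pverts F. \<forall>y\<in>pverts F. x < y \<longrightarrow> (f x \<sim> f y \<longleftrightarrow> (x, y) \<in> parcs F)"
  shows False
  using free contains_inducedI[of F f] assms pair_graph_forbidden unfolding free_of_def by blast

text \<open>Here and in the next lemmas the variables follow the numbering of the pattern, and
  \<open>contains_inducedI\<close> supplies their distinctness.\<close>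

lemma no_F1:
  assumes "a \<sim> b" "a \<sim> c" "b \<sim> c" "d \<sim> e"
    "\<not> a \<sim> d" "\<not> a \<sim> e" "\<not> b \<sim> d" "\<not> b \<sim> e" "\<not> c \<sim> d" "\<not> c \<sim> e"
  shows False
  by (rule no_forbidden[of F1 "(!) [a, b, c, d, e]"])
    (simp_all add: forbidden_members, simp_all add: F1_def small_intervals assms)

lemma no_F2:
  assumes "a \<sim> b" "a \<sim> c" "b \<sim> c" "a \<sim> d" "b \<sim> e" "c \<sim> f"
    "\<not> a \<sim> e" "\<not> a \<sim> f" "\<not> b \<sim> d" "\<not> b \<sim> f" "\<not> c \<sim> d" "\<not> c \<sim> e" "\<not> d \<sim> e"
    "\<not> d \<sim> f" "\<not> e \<sim> f"
  shows False
  by (rule no_forbidden[of F2 "(!) [a, b, c, d, e, f]"])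
    (simp_all add: forbidden_members, simp_all add: F2_def small_intervals assms)

lemma no_F3:
  assumes "a \<sim> b" "a \<sim> c" "b \<sim> c" "b \<sim> d" "d \<sim> e" "c \<sim> f" "f \<sim> g"
    "\<not> a \<sim> d" "\<not> a \<sim> e" "\<not> a \<sim> f" "\<not> a \<sim> g" "\<not> b \<sim> e" "\<not> b \<sim> f" "\<not> b \<sim> g"
    "\<not> c \<sim> d" "\<not> c \<sim> e" "\<not> c \<sim> g" "\<not> d \<sim> f" "\<not> d \<sim> g" "\<not> e \<sim> f" "\<not> e \<sim> g"
  shows False
  by (rule no_forbidden[of F3 "(!) [a, b, c, d, e, f, g]"])
    (simp_all add: forbidden_members, simp_all add: F3_def small_intervals assms)

lemma no_F4:
  assumes "a \<sim> b" "a \<sim> c" "b \<sim> c" "b \<sim> d" "c \<sim> e" "a \<sim> f" "c \<sim> f" "a \<sim> g" "b \<sim> g"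
    "\<not> a \<sim> d" "\<not> a \<sim> e" "\<not> b \<sim> e" "\<not> b \<sim> f" "\<not> c \<sim> d" "\<not> c \<sim> g" "\<not> d \<sim> e"
    "\<not> d \<sim> f" "\<not> d \<sim> g" "\<not> e \<sim> f" "\<not> e \<sim> g" "\<not> f \<sim> g"
  shows False
  by (rule no_forbidden[of F4 "(!) [a, b, c, d, e, f, g]"])
    (simp_all add: forbidden_members, simp_all add: F4_def small_intervals assms)

lemma no_F5:
  assumes "a \<sim> b" "b \<sim> c" "b \<sim> d" "c \<sim> d" "d \<sim> e" "a \<sim> f" "b \<sim> f" "d \<sim> f" "e \<sim> f"
    "\<not> a \<sim> c" "\<not> a \<sim> d" "\<not> a \<sim> e" "\<not> b \<sim> e" "\<not> c \<sim> e" "\<not> c \<sim> f"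
  shows False
  \<comment> \<open>The vertices of \<open>F5\<close> are numbered from 1, so entry 0 of the list is
    a filler; likewise for \<open>F6\<close>.\<close>
  by (rule no_forbidden[of F5 "(!) [a, a, b, c, d, e, f]"])
    (simp_all add: forbidden_members, simp_all add: F5_def small_intervals assms)

lemma no_F6:
  assumes "a \<sim> b" "a \<sim> c" "b \<sim> c" "b \<sim> d" "c \<sim> d" "c \<sim> e" "d \<sim> e" "d \<sim> f" "e \<sim> f"
    "\<not> a \<sim> d" "\<not> a \<sim> e" "\<not> a \<sim> f" "\<not> b \<sim> e" "\<not> b \<sim> f" "\<not> c \<sim> f"
  shows False
  by (rule no_forbidden[of F6 "(!) [a, a, b, c, d, e, f]"])
    (simp_all add: forbidden_members, simp_all add: F6_def small_intervals assms)

lemma no_F7: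
  assumes "a \<sim> b" "a \<sim> c" "b \<sim> c" "a \<sim> d" "b \<sim> d" "c \<sim> d"
  shows False
  by (rule no_forbidden[of F7 "(!) [a, b, c, d]"])
    (simp_all add: forbidden_members, simp_all add: F7_def small_intervals assms)

subsection \<open>A vertex common to all triangles\<close>

definition triangle :: "'a set \<Rightarrow> bool" where
  "triangle T \<longleftrightarrow> (\<exists>a b c. T = {a, b, c} \<and> a \<sim> b \<and> a \<sim> c \<and> b \<sim> c)"

lemma triangleI: "a \<sim> b \<Longrightarrow> a \<sim> c \<Longrightarrow> b \<sim> c \<Longrightarrow> triangle {a, b, c}"
  unfolding triangle_def by blast

lemma triangle_adj: "triangle T \<Longrightarrow> x \<in> T \<Longrightarrow> y \<in> T \<Longrightarrow> x \<noteq> y \<Longrightarrow> x \<sim> y"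
  unfolding triangle_def using adj_sym by blast

lemma triangle_third:
  assumes "triangle T" "x \<in> T" "y \<in> T" "x \<noteq> y"
  obtains z where "T = {x, y, z}" "x \<sim> y" "x \<sim> z" "y \<sim> z"
proof -
  obtain a b c where T: "T = {a, b, c}" and e: "a \<sim> b" "a \<sim> c" "b \<sim> c"
    using assms(1) unfolding triangle_def by blast
  have e': "b \<sim> a" "c \<sim> a" "c \<sim> b" using e by (simp_all add: adj_sym)
  from assms(2-4)[unfolded T] consider "x = a" "y = b" | "x = a" "y = c" | "x = b" "y = c"
    | "x = b" "y = a" | "x = c" "y = a" | "x = c" "y = b" by blast
  then show thesis
    by cases (use that[of a] that[of b] that[of c] e e' in \<open>auto simp: T insert_commute\<close>)
qed

lemma triangle_others:
  assumes "triangle T" "x \<in> T"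
  obtains y z where "T = {x, y, z}" "x \<sim> y" "x \<sim> z" "y \<sim> z"
proof -
  have "\<exists>y\<in>T. x \<noteq> y" using assms unfolding triangle_def by (metis adj_irrefl insertCI)
  with assms triangle_third that show thesis by metis
qed

section \<open>Any two triangles share a vertex\<close>

lemma K4_free:
  assumes "a \<sim> b" "a \<sim> c" "b \<sim> c" "a \<sim> d" "b \<sim> d"
  shows "\<not> c \<sim> d"
  using no_F7[of a b c d] assms by blast

lemma square:
  assumes "a \<sim> b" "b \<sim> c" "c \<sim> d" "d \<sim> a" "a \<noteq> c" "b \<noteq> d"
  shows "a \<sim> c \<or> b \<sim> d"
  using no_C4[of a b c d] assms adj_sym by blast

lemma triangle_edge:
  assumes "triangle T" "u \<sim> v"
  shows "\<exists>x\<in>T. x \<sim> u \<or> x \<sim> v"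
proof -
  obtain a b c where "T = {a, b, c}" "a \<sim> b" "a \<sim> c" "b \<sim> c"
    using assms(1) unfolding triangle_def by blast
  then show ?thesis using no_F1[of a b c u v] assms(2) by blast
qed

text \<open>By \<open>triangle_edge\<close> every edge of \<open>U\<close> has an end with a
  neighbour in \<open>T\<close>, so two vertices \<open>p\<close>, \<open>q\<close> of
  \<open>U\<close> have neighbours \<open>x\<close>, \<open>y\<close> in \<open>T\<close>. If
  \<open>x\<close> and \<open>y\<close> differ, a chord of the 4-cycle \<open>x y q p\<close> makes
  one of them adjacent to both \<open>p\<close> and \<open>q\<close>.\<close>

lemma disjoint_triangles_two:
  assumes T: "triangle T" and U: "triangle U" and disj: "T \<inter> U = {}"
  obtains z p q where "z \<in> T" "p \<in> U" "q \<in> U" "p \<noteq> q" "z \<sim> p" "z \<sim> q"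
proof -
  have common: "\<exists>z\<in>T. z \<sim> p \<and> z \<sim> q"
    if "p \<in> U" "q \<in> U" "p \<noteq> q" "x \<in> T" "y \<in> T" "x \<sim> p" "y \<sim> q" for p q x y
  proof (cases "x = y")
    case False
    then have "x \<sim> y" "p \<sim> q" "x \<noteq> q" "y \<noteq> p"
      using that triangle_adj T U disj by blast+
    then show ?thesis using square[of x y q p] that adj_sym by blast
  qed (use that in blast)
  obtain d e f where U': "U = {d, e, f}" and e: "d \<sim> e" "d \<sim> f" "e \<sim> f"
    using U unfolding triangle_def by blast
  have "d \<noteq> e" "d \<noteq> f" "e \<noteq> f" using e by auto
  moreover from e triangle_edge[OF T] have
    "\<exists>x\<in>T. x \<sim> d \<or> x \<sim> e" "\<exists>x\<in>T. x \<sim> d \<or> x \<sim> f" "\<exists>x\<in>T. x \<sim> e \<or> x \<sim> f"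
    by blast+
  then consider "\<exists>x\<in>T. \<exists>y\<in>T. x \<sim> d \<and> y \<sim> e" | "\<exists>x\<in>T. \<exists>y\<in>T. x \<sim> d \<and> y \<sim> f"
    | "\<exists>x\<in>T. \<exists>y\<in>T. x \<sim> e \<and> y \<sim> f" by blast
  then have "\<exists>z\<in>T. \<exists>p\<in>U. \<exists>q\<in>U. p \<noteq> q \<and> z \<sim> p \<and> z \<sim> q"
    using common[of d e] common[of d f] common[of e f] \<open>d \<noteq> e\<close> \<open>d \<noteq> f\<close> \<open>e \<noteq> f\<close>
    unfolding U' by cases blast+
  with that show thesis by blast
qed

text \<open>Any further edge between the triangles would create a \<open>K_4\<close> or a chordless
  4-cycle, so \<open>c b a d e f\<close> is the order of the path whose square is
  \<open>F6\<close>.\<close>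

lemma disjoint_triangles_no_F6:
  assumes T: "a \<sim> b" "a \<sim> c" "b \<sim> c" and U: "d \<sim> e" "d \<sim> f" "e \<sim> f"
    and disj: "{a, b, c} \<inter> {d, e, f} = {}"
    and e: "a \<sim> d" "a \<sim> e" "b \<sim> d"
  shows False
proof -
  note sym = adj_sym[of b a] adj_sym[of c a] adj_sym[of c b] adj_sym[of d a] adj_sym[of d b]
    adj_sym[of e a] adj_sym[of e d] adj_sym[of e b] adj_sym[of f d] adj_sym[of f e]
    adj_sym[of f a] adj_sym[of f b] adj_sym[of f c] adj_sym[of e c] adj_sym[of d c]
  have "\<not> c \<sim> d" using K4_free[of a b c d] assms by blast
  moreover have "\<not> b \<sim> e" using K4_free[of a d b e] assms sym by blast
  moreover have "\<not> a \<sim> f" using K4_free[of d e a f] assms sym by blast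
  moreover have "\<not> c \<sim> e"
    using square[of c b d e] assms sym \<open>\<not> c \<sim> d\<close> \<open>\<not> b \<sim> e\<close> by blast
  moreover have "\<not> b \<sim> f"
    using square[of b f e a] assms sym \<open>\<not> b \<sim> e\<close> \<open>\<not> a \<sim> f\<close> by blast
  moreover have "\<not> c \<sim> f"
    using square[of c f d b] assms sym \<open>\<not> c \<sim> d\<close> \<open>\<not> b \<sim> f\<close> by blast
  ultimately show False using no_F6[of c b a d e f] assms sym by blast
qed

text \<open>An edge from \<open>s\<close> to \<open>p\<close> or \<open>q\<close> yields
  \<open>F6\<close>. An edge from \<open>s\<close> to the third vertex \<open>r\<close> leaves the
  4-cycle \<open>z p r s\<close> without a chord, since \<open>z \<sim> r\<close> would complete a
  \<open>K_4\<close>.\<close>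

lemma disjoint_triangles_one:
  assumes T: "triangle T" and U: "triangle U" and disj: "T \<inter> U = {}"
    and z: "z \<in> T" "p \<in> U" "q \<in> U" "p \<noteq> q" "z \<sim> p" "z \<sim> q"
    and s: "s \<in> T" "s \<noteq> z" "u \<in> U"
  shows "\<not> s \<sim> u"
proof
  assume su: "s \<sim> u"
  obtain t where t: "T = {z, s, t}" "z \<sim> s" "z \<sim> t" "s \<sim> t"
    using triangle_third[OF T z(1) s(1)] s(2) by metis
  obtain r where r: "U = {p, q, r}" "p \<sim> q" "p \<sim> r" "q \<sim> r"
    using triangle_third[OF U z(2,3,4)] by metis
  have d: "{z, s, t} \<inter> {p, q, r} = {}" "{z, s, t} \<inter> {q, p, r} = {}"
    using disj t(1) r(1) by auto
  have np: "\<not> s \<sim> p"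
    using disjoint_triangles_no_F6[OF t(2,3,4) r(2,3,4) d(1)] z by blast
  have nq: "\<not> s \<sim> q"
    using disjoint_triangles_no_F6[OF t(2,3,4) _ r(4,3) d(2)] z r(2) adj_sym by blast
  have "s \<sim> r" using su s(3) np nq r(1) by blast
  moreover have "\<not> z \<sim> r" using K4_free[of p q z r] r z adj_sym by blast
  ultimately show False
    using square[of z p r s] np z(5) r(3) t(2) d(1) adj_sym by blast
qed

text \<open>Applying \<open>disjoint_triangles_two\<close> in both directions gives two vertices of
  \<open>T\<close> with neighbours in \<open>U\<close>, whereas
  \<open>disjoint_triangles_one\<close> leaves only \<open>z\<close>.\<close>

lemma triangles_meet:
  assumes "triangle T" "triangle U"
  shows "T \<inter> U \<noteq> {}"
proof
  assume d: "T \<inter> U = {}"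
  obtain z p q where z: "z \<in> T" "p \<in> U" "q \<in> U" "p \<noteq> q" "z \<sim> p" "z \<sim> q"
    using disjoint_triangles_two[OF assms d] by blast
  obtain u s t where "u \<in> U" "s \<in> T" "t \<in> T" "s \<noteq> t" "u \<sim> s" "u \<sim> t"
    using disjoint_triangles_two[OF assms(2,1)] d by blast
  then show False
    using disjoint_triangles_one[OF assms d z] adj_sym by blast
qed

section \<open>From pairwise intersection to a common vertex\<close>

definition hits :: "'a \<Rightarrow> bool" where
  "hits x \<longleftrightarrow> (\<forall>T. triangle T \<longrightarrow> x \<in> T)"

lemma hits_adj: "hits x \<Longrightarrow> a \<sim> b \<Longrightarrow> a \<sim> c \<Longrightarrow> b \<sim> c \<Longrightarrow> x = a \<or> x = b \<or> x = c"
  using triangleI unfolding hits_def by blast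

text \<open>Since \<open>c\<close> and \<open>d\<close> are not adjacent, every triangle contains
  \<open>a\<close> or \<open>b\<close>. Triangles avoiding \<open>a\<close> and \<open>b\<close>
  respectively share a vertex \<open>x\<close>, and a third avoids \<open>x\<close>. They hang on
  the three sides of the triangle \<open>a b x\<close>, which is the 3-sun
  \<open>F5\<close>.\<close>

lemma shared_edge:
  assumes no: "\<And>x. \<not> hits x"
    and e: "a \<sim> b" "a \<sim> c" "b \<sim> c" "a \<sim> d" "b \<sim> d" and cd: "c \<noteq> d"
  shows False
proof -
  have ncd: "\<not> c \<sim> d" using K4_free e by blast
  have tri: "triangle {a, b, c}" "triangle {a, b, d}" using e triangleI by auto
  have either: "a \<in> T \<or> b \<in> T" if "triangle T" for T
    using triangles_meet[OF that tri(1)] triangles_meet[OF that tri(2)]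
      triangle_adj[OF that, of c d] ncd cd by blast
  obtain T3 T4 where T: "triangle T3" "a \<notin> T3" "triangle T4" "b \<notin> T4"
    using no unfolding hits_def by blast
  then have in34: "b \<in> T3" "a \<in> T4" using either by blast+
  obtain x where x: "x \<in> T3" "x \<in> T4" using triangles_meet[OF T(1,3)] by blast
  obtain y where y: "T3 = {b, x, y}" "b \<sim> x" "b \<sim> y" "x \<sim> y"
    using triangle_third[OF T(1) in34(1) x(1)] x T by metis
  obtain z where z: "T4 = {a, x, z}" "a \<sim> x" "a \<sim> z" "x \<sim> z"
    using triangle_third[OF T(3) in34(2) x(2)] x T by metis
  have nay: "\<not> a \<sim> y" using K4_free[of b x a y] y z e adj_sym by blast
  have nbz: "\<not> b \<sim> z" using K4_free[of a x b z] y z e adj_sym by blast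
  \<comment> \<open>Avoiding \<open>x\<close>, this triangle needs both \<open>a\<close> and
    \<open>b\<close>: without \<open>a\<close> it would contain the non-adjacent \<open>b\<close>
    and \<open>z\<close>, without \<open>b\<close> the non-adjacent \<open>a\<close> and
    \<open>y\<close>.\<close>
  obtain T5 where T5: "triangle T5" "x \<notin> T5" using no unfolding hits_def by blast
  have "a \<in> T5"
  proof (rule ccontr)
    assume a: "a \<notin> T5"
    then have "z \<in> T5" "b \<in> T5" using triangles_meet[OF T5(1) T(3)] either[OF T5(1)] T5 z by blast+
    then show False using triangle_adj[OF T5(1), of b z] nbz z T by blast
  qed
  moreover have "b \<in> T5"
  proof (rule ccontr)
    assume b: "b \<notin> T5"
    then have "y \<in> T5" "a \<in> T5" using triangles_meet[OF T5(1) T(1)] either[OF T5(1)] T5 y by blast+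
    then show False using triangle_adj[OF T5(1), of a y] nay y T by blast
  qed
  moreover have "a \<noteq> b" using e by auto
  ultimately obtain w where w: "T5 = {a, b, w}" "a \<sim> w" "b \<sim> w"
    using triangle_third[OF T5(1)] by metis
  have nwx: "\<not> w \<sim> x" using K4_free[of a b w x] w y z e by blast
  have nyz: "\<not> z \<sim> y"
    using square[of a b y z] e y z nay nbz T adj_sym by blast
  have nwy: "\<not> w \<sim> y"
    using square[of a w y x] w y z nay nwx T T5 adj_sym by blast
  have nwz: "\<not> w \<sim> z"
    using square[of b w z x] w y z nbz nwx T T5 adj_sym by blast
  show False
    by (rule no_F5[of w a z x y b])
      (use w y z e nwx nyz nwy nwz nay nbz in \<open>simp_all add: adj_sym\<close>)
qed

text \<open>Otherwise \<open>shared_edge\<close> forbids two triangles on one edge. If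
  \<open>T\<close> and \<open>U\<close> meet only in \<open>b\<close>, a triangle avoiding
  \<open>b\<close> meets them in \<open>v\<close> and \<open>w\<close>, and \<open>b v w\<close>
  shares the edge \<open>b v\<close> with \<open>T\<close>.\<close>

lemma triangles_common_vertex: "\<exists>x. hits x"
proof (rule ccontr)
  assume "\<not> ?thesis"
  then have no: "\<not> hits x" for x by blast
  obtain T where T: "triangle T" using no unfolding hits_def by blast
  then obtain a where a: "a \<in> T" unfolding triangle_def by blast
  obtain U where U: "triangle U" "a \<notin> U" using no unfolding hits_def by blast
  obtain b where b: "b \<in> T" "b \<in> U" using triangles_meet[OF T U(1)] by blast
  obtain c where c: "T = {b, a, c}" "b \<sim> a" "b \<sim> c" "a \<sim> c"
    using triangle_third[OF T b(1) a] b U by metis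
  show False
  proof (cases "c \<in> U")
    case True
    then obtain d where "U = {b, c, d}" "b \<sim> c" "b \<sim> d" "c \<sim> d"
      using triangle_third[OF U(1) b(2)] c by (metis adj_irrefl)
    then show False using shared_edge[OF no, of b c a d] c U adj_sym by blast
  next
    case False
    obtain W where W: "triangle W" "b \<notin> W" using no unfolding hits_def by blast
    obtain v where v: "v \<in> T" "v \<in> W" using triangles_meet[OF T W(1)] by blast
    obtain w where w: "w \<in> U" "w \<in> W" using triangles_meet[OF U(1) W(1)] by blast
    have vU: "v \<notin> U" using v False U b W c by blast
    have wT: "w \<notin> T" using w False U W c by blast
    have "v \<sim> w" using triangle_adj[OF W(1)] v w vU by blast
    moreover have "b \<sim> v" "b \<sim> w"
      using triangle_adj[OF T b(1) v(1)] triangle_adj[OF U(1) b(2) w(1)] v w W by blast+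
    moreover obtain t where "T = {b, v, t}" "b \<sim> t" "v \<sim> t"
      using triangle_third[OF T b(1) v(1)] v W by metis
    ultimately show False using shared_edge[OF no, of b v t w] wT by blast
  qed
qed

subsection \<open>Good vertices\<close>

text \<open>The last two conjuncts exclude odd walks of length 1 and 3 between non-neighbours of
  \<open>c\<close>; longer shortest ones are excluded by \<open>fan\<close>.\<close>

definition good :: "'a \<Rightarrow> bool" where
  "good c \<longleftrightarrow> hits c \<and>
     (\<forall>u v. u \<sim> v \<longrightarrow> u = c \<or> v = c \<or> c \<sim> u \<or> c \<sim> v) \<and>
     (\<forall>p q r s. p \<sim> q \<longrightarrow> q \<sim> r \<longrightarrow> r \<sim> s \<longrightarrow> c \<sim> q \<longrightarrow> c \<sim> r \<longrightarrow> \<not> p \<sim> s \<longrightarrow>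
        p = c \<or> s = c \<or> c \<sim> p \<or> c \<sim> s)"

text \<open>
  An edge avoiding \<open>N[x]\<close>: exactly one neighbour \<open>s\<close> of \<open>x\<close> can touch the edge, and every
  triangle must contain a vertex that does.
\<close>

lemma edge_obstruction:
  assumes ex: "triangle T0" and x: "hits x"
    and uv: "u \<sim> v" "u \<noteq> x" "v \<noteq> x" "\<not> x \<sim> u" "\<not> x \<sim> v"
  shows "\<exists>s u v. hits s \<and> x \<sim> s \<and> s \<sim> u \<and> u \<sim> v \<and> u \<noteq> x \<and> v \<noteq> x \<and> v \<noteq> s \<and>
    \<not> x \<sim> u \<and> \<not> x \<sim> v \<and> \<not> s \<sim> v \<and> (\<forall>t. x \<sim> t \<longrightarrow> t \<noteq> s \<longrightarrow> \<not> t \<sim> u \<and> \<not> t \<sim> v)"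
proof -
  define near where "near s \<longleftrightarrow> s \<sim> u \<or> s \<sim> v" for s
  have both: "\<not> (s \<sim> u \<and> s \<sim> v)" if "x \<sim> s" for s
    using hits_adj[OF x, of s u v] that uv adj_irrefl by metis
  \<comment> \<open>Two such neighbours with a common end \<open>w\<close> close a 4-cycle with
    \<open>x\<close>, whose chord gives a triangle missing \<open>x\<close>. With different ends
    they give a chordless 4-cycle or an induced 5-cycle through \<open>x\<close>.\<close>
  have same: "s = t" if s: "x \<sim> s" "near s" and t: "x \<sim> t" "near t" for s t
  proof (rule ccontr)
    assume ne: "s \<noteq> t"
    have no_common: False if "w = u \<or> w = v" "s \<sim> w" "t \<sim> w" for w
    proof -
      have "\<not> x \<sim> w" "w \<noteq> x" using that uv by auto
      then have "s \<sim> t" using square[of x s w t] s t that ne adj_sym by blast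
      then show False
        using hits_adj[OF x, of s t w] that s t \<open>w \<noteq> x\<close> by (metis adj_irrefl)
    qed
    have path: False if w: "w \<sim> w'" "s \<sim> w" "t \<sim> w'" "\<not> s \<sim> w'" "\<not> t \<sim> w"
      "\<not> x \<sim> w" "\<not> x \<sim> w'" for w w'
    proof -
      have "s \<noteq> w'" "t \<noteq> w" using s(1) t(1) w by blast+
      then have "\<not> s \<sim> t" using square[of s w w' t] w adj_sym by blast
      then show False using no_C5[of x s w w' t] s(1) t(1) w adj_sym by blast
    qed
    show False
      using no_common[of u] no_common[of v] path[of u v] path[of v u] s t uv adj_sym
      unfolding near_def by blast
  qed
  obtain a b where ab: "T0 = {x, a, b}" "x \<sim> a" "x \<sim> b" "a \<sim> b"
    using triangle_others[OF ex] x ex unfolding hits_def by metis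
  have touch: "\<exists>s\<in>T. x \<sim> s \<and> near s" if T: "triangle T" for T
  proof -
    obtain s where "s \<in> T" "near s" using triangle_edge[OF T uv(1)] near_def by blast
    moreover have "x \<in> T" using x T unfolding hits_def by blast
    moreover have "\<not> near x" using uv near_def by blast
    ultimately show ?thesis using triangle_adj[OF T] by metis
  qed
  obtain s where s: "x \<sim> s" "near s" using touch[OF ex] by blast
  have "hits s" unfolding hits_def using touch same s by metis
  moreover have "\<not> t \<sim> u \<and> \<not> t \<sim> v" if "x \<sim> t" "t \<noteq> s" for t
    using same that s near_def by blast
  moreover have "s \<noteq> u" "s \<noteq> v" using s uv by blast+
  \<comment> \<open>The names \<open>u\<close> and \<open>v\<close> are exchanged if
    \<open>s\<close> is adjacent to the second end.\<close>
  ultimately show ?thesis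
    using s uv both[OF s(1)] adj_sym unfolding near_def by metis
qed

text \<open>By \<open>F2\<close> every neighbour of \<open>x\<close> sees \<open>q\<close> or
  \<open>r\<close>. A triangle avoiding both then yields a \<open>K_4\<close> or a chordless 4-cycle
  through \<open>q r\<close>, so each triangle contains \<open>q\<close> or \<open>r\<close>. If
  neither lies in all of them, the triangles \<open>x r f\<close> and \<open>x q g\<close> complete
  the bull to \<open>F4\<close>.\<close>

lemma bull_obstruction:
  assumes ex: "triangle T0" and x: "hits x"
    and b: "p \<sim> q" "q \<sim> r" "r \<sim> s" "x \<sim> q" "x \<sim> r" "\<not> p \<sim> s"
      "p \<noteq> x" "s \<noteq> x" "\<not> x \<sim> p" "\<not> x \<sim> s"
  shows "hits q \<or> hits r"
proof (rule ccontr)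
  assume no: "\<not> ?thesis"
  have npr: "\<not> p \<sim> r" using hits_adj[OF x, of p q r] b by (metis adj_irrefl)
  have nqs: "\<not> q \<sim> s" using hits_adj[OF x, of q r s] b by (metis adj_irrefl)
  have ne: "p \<noteq> r" "q \<noteq> s" using b by auto
  have dom: "y \<sim> q \<or> y \<sim> r" if y: "x \<sim> y" for y
  proof (rule ccontr)
    assume n: "\<not> ?thesis"
    then have "y \<noteq> q" "y \<noteq> r" using b adj_sym by blast+
    then have "\<not> y \<sim> p" "\<not> y \<sim> s"
      using square[of x q p y] square[of x r s y] b y n adj_sym by blast+
    then show False
      by (intro no_F2[of x q r y p s]) (use b y n npr nqs in \<open>simp_all add: adj_sym\<close>)
  qed
  have meet: "q \<in> T \<or> r \<in> T" if T: "triangle T" for T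
  proof (rule ccontr)
    assume n: "\<not> ?thesis"
    obtain a c where a: "T = {x, a, c}" "x \<sim> a" "x \<sim> c" "a \<sim> c"
      using triangle_others[OF T] x T unfolding hits_def by metis
    have ne: "a \<noteq> q" "a \<noteq> r" "c \<noteq> q" "c \<noteq> r" using n a by auto
    have k: "\<not> (a \<sim> q \<and> c \<sim> q)" "\<not> (a \<sim> r \<and> c \<sim> r)" "\<not> (a \<sim> q \<and> a \<sim> r)" "\<not> (c \<sim> q \<and> c \<sim> r)"
      using K4_free[of x a c q] K4_free[of x a c r] K4_free[of x q r a] K4_free[of x q r c] a b adj_sym by blast+
    then consider "a \<sim> q" "c \<sim> r" | "a \<sim> r" "c \<sim> q" using dom a by blast
    then show False
      using square[of a q r c] square[of c q r a] k ne a b adj_sym by cases blast+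
  qed
  obtain T U where T: "triangle T" "q \<notin> T" and U: "triangle U" "r \<notin> U"
    using no unfolding hits_def by blast
  have "x \<in> T" "x \<in> U" "r \<in> T" "q \<in> U" "x \<noteq> r" "x \<noteq> q"
    using x T U meet b adj_irrefl unfolding hits_def by blast+
  then obtain f g where f: "T = {x, r, f}" "x \<sim> f" "r \<sim> f" and g: "U = {x, q, g}" "x \<sim> g" "q \<sim> g"
    using triangle_third[OF T(1), of x r] triangle_third[OF U(1), of x q] by metis
  have nqf: "\<not> q \<sim> f" and nrg: "\<not> r \<sim> g"
    using K4_free[of x r f q] K4_free[of x q g r] b f g T U adj_sym by blast+
  have nfg: "\<not> f \<sim> g" using square[of f g q r] b f g nqf nrg T U adj_sym by blast
  have npf: "\<not> p \<sim> f" using square[of x q p f] b f nqf T adj_sym by blast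
  have nsg: "\<not> s \<sim> g" using square[of x r s g] b g nrg U adj_sym by blast
  have npg: "\<not> p \<sim> g" using hits_adj[OF x, of p q g] b g adj_irrefl by metis
  have nsf: "\<not> s \<sim> f" using hits_adj[OF x, of s r f] b f adj_sym adj_irrefl by metis
  show False
    by (rule no_F4[of x q r p s f g])
      (use b f g npr nqs nqf nrg nfg npf nsg npg nsf in \<open>simp_all add: adj_sym\<close>)
qed

text \<open>Together with \<open>x \<sim> s\<close>, which \<open>partner\<close> supplies, this is
  an induced path \<open>x s u v\<close> whose end edge is out of reach of all other neighbours of
  \<open>x\<close>.\<close>

definition edge_partner :: "'a \<Rightarrow> 'a \<Rightarrow> bool" where
  "edge_partner x s \<longleftrightarrow> (\<exists>u v. s \<sim> u \<and> u \<sim> v \<and> u \<noteq> x \<and> v \<noteq> x \<and> v \<noteq> s \<and>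
    \<not> x \<sim> u \<and> \<not> x \<sim> v \<and> \<not> s \<sim> v \<and> (\<forall>t. x \<sim> t \<longrightarrow> t \<noteq> s \<longrightarrow> \<not> t \<sim> u \<and> \<not> t \<sim> v))"

definition bull_partner :: "'a \<Rightarrow> 'a \<Rightarrow> bool" where
  "bull_partner x q \<longleftrightarrow> (\<exists>p r s. p \<sim> q \<and> q \<sim> r \<and> r \<sim> s \<and> x \<sim> r \<and> \<not> p \<sim> s \<and>
    p \<noteq> x \<and> s \<noteq> x \<and> \<not> x \<sim> p \<and> \<not> x \<sim> s)"

definition partner :: "'a \<Rightarrow> 'a \<Rightarrow> bool" where
  "partner x s \<longleftrightarrow> hits s \<and> x \<sim> s \<and> (edge_partner x s \<or> bull_partner x s)"

lemma obtain_partner: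
  assumes ex: "triangle T0" and x: "hits x" "\<not> good x"
  obtains s where "partner x s"
proof -
  consider (edge) u v where "u \<sim> v" "u \<noteq> x" "v \<noteq> x" "\<not> x \<sim> u" "\<not> x \<sim> v"
    | (bull) p q r s where "p \<sim> q" "q \<sim> r" "r \<sim> s" "x \<sim> q" "x \<sim> r" "\<not> p \<sim> s"
      "p \<noteq> x" "s \<noteq> x" "\<not> x \<sim> p" "\<not> x \<sim> s"
    using x unfolding good_def by blast
  then show thesis
  proof cases
    case edge
    show thesis
      using edge_obstruction[OF ex x(1) edge] that unfolding partner_def edge_partner_def by blast
  next
    case bull
    \<comment> \<open>A bull read backwards is again a bull, so either base vertex
      qualifies.\<close>
    have "bull_partner x q" "bull_partner x r"
      using bull adj_sym unfolding bull_partner_def by metis+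
    then show thesis
      using bull_obstruction[OF ex x(1) bull] that bull unfolding partner_def by blast
  qed
qed

text \<open>Both kinds of witness contain such a vertex: \<open>u\<close> for an edge,
  \<open>p\<close> for a bull. These serve as the pendant vertices of nets.\<close>

lemma partner_pendant:
  assumes "partner x s"
  obtains w where "s \<sim> w" "\<not> x \<sim> w" "w \<noteq> x"
proof -
  from assms consider "edge_partner x s" | "bull_partner x s" unfolding partner_def by blast
  then show thesis
  proof cases
    case 1
    then show thesis using that unfolding edge_partner_def by blast
  next
    case 2
    then show thesis using that adj_sym unfolding bull_partner_def by blast
  qed
qed

text \<open>The neighbour \<open>w\<close> is the missing pendant at the nose:
  \<open>r \<sim> w\<close> would give a triangle without \<open>q\<close>, and an edge from
  \<open>w\<close> to \<open>p\<close> or \<open>s\<close> a chordless 4-cycle. So the bull and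
  \<open>w\<close> form \<open>F2\<close>.\<close>

lemma bull_partner_net:
  assumes x: "hits x" and q: "hits q" "x \<sim> q" "bull_partner x q"
    and w: "x \<sim> w" "\<not> q \<sim> w" "w \<noteq> q"
  shows False
proof -
  obtain p r s where b: "p \<sim> q" "q \<sim> r" "r \<sim> s" "x \<sim> r" "\<not> p \<sim> s"
    "p \<noteq> x" "s \<noteq> x" "\<not> x \<sim> p" "\<not> x \<sim> s"
    using q(3) unfolding bull_partner_def by blast
  have npr: "\<not> p \<sim> r" using hits_adj[OF x, of p q r] b q(2) by (metis adj_irrefl)
  have nqs: "\<not> q \<sim> s" using hits_adj[OF x, of q r s] b q(2) by (metis adj_irrefl)
  have nrw: "\<not> r \<sim> w" using hits_adj[OF q(1), of x r w] b q(2) w by (metis adj_irrefl)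
  have "w \<noteq> r" using w b by blast
  then have npw: "\<not> p \<sim> w" and nsw: "\<not> s \<sim> w"
    using square[of x q p w] square[of x r s w] b q(2) w nrw adj_sym by blast+
  show False
    by (rule no_F2[of x q r w p s])
      (use b q(2) w npr nqs nrw npw nsw in \<open>simp_all add: adj_sym\<close>)
qed

text \<open>The two witnesses are paths \<open>s u v\<close> and \<open>x w z\<close> attached to a
  triangle \<open>c s x\<close>. Their isolation conditions leave only \<open>v \<sim> z\<close> to
  exclude, which would close an induced 6-cycle.\<close>

lemma edge_partners_F3:
  assumes ex: "triangle T0" and x: "hits x" and s: "hits s" "x \<sim> s"
    and xs: "edge_partner x s" and sx: "edge_partner s x"
  shows False
proof -
  obtain u v where u: "s \<sim> u" "u \<sim> v" "u \<noteq> x" "v \<noteq> x" "v \<noteq> s" "\<not> x \<sim> u" "\<not> x \<sim> v" "\<not> s \<sim> v"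
    and ut: "\<And>t. x \<sim> t \<Longrightarrow> t \<noteq> s \<Longrightarrow> \<not> t \<sim> u \<and> \<not> t \<sim> v"
    using xs unfolding edge_partner_def by blast
  obtain w z where w: "x \<sim> w" "w \<sim> z" "w \<noteq> s" "z \<noteq> s" "z \<noteq> x" "\<not> s \<sim> w" "\<not> s \<sim> z" "\<not> x \<sim> z"
    and wt: "\<And>t. s \<sim> t \<Longrightarrow> t \<noteq> x \<Longrightarrow> \<not> t \<sim> w \<and> \<not> t \<sim> z"
    using sx unfolding edge_partner_def by blast
  have "x \<in> T0" "s \<in> T0" "x \<noteq> s" using x s ex unfolding hits_def by auto
  then obtain c where c: "x \<sim> c" "s \<sim> c" using triangle_third[OF ex] by metis
  then have "c \<noteq> s" "c \<noteq> x" by auto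
  then have nc: "\<not> c \<sim> u" "\<not> c \<sim> v" "\<not> c \<sim> w" "\<not> c \<sim> z" using ut wt c by blast+
  have nu: "\<not> u \<sim> w" "\<not> u \<sim> z" using wt u by blast+
  have nw: "\<not> w \<sim> v" using ut w by blast
  have nvz: "\<not> v \<sim> z"
    using no_C6[of x s u v z w] u w nu nw s(2) adj_sym by blast
  show False
    by (rule no_F3[of c s x u v w z])
      (use u w c nc nu nw nvz s(2) in \<open>simp_all add: adj_sym\<close>)
qed

text \<open>If one of the two is a bull partner, the pendant vertex from the other direction
  completes a net; otherwise both are edge partners and \<open>F3\<close> appears.\<close>

lemma mutual_partners:
  assumes ex: "triangle T0" and x: "hits x" and p: "partner x s" "partner s x"
  shows False
proof -
  have s: "hits s" "x \<sim> s" "s \<sim> x" using p adj_sym unfolding partner_def by blast+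
  obtain w where "s \<sim> w" "\<not> x \<sim> w" "w \<noteq> x" using partner_pendant[OF p(1)] by blast
  moreover obtain z where "x \<sim> z" "\<not> s \<sim> z" "z \<noteq> s" using partner_pendant[OF p(2)] by blast
  ultimately show False
    using p x s bull_partner_net[of x s z] bull_partner_net[of s x w] edge_partners_F3[OF ex x]
    unfolding partner_def by blast
qed

text \<open>Each pendant vertex sees just one vertex of the triangle \<open>x s t\<close>, as
  another edge would give a triangle missing a common vertex. An edge between two pendants would
  make a chordless 4-cycle, so the six vertices form \<open>F2\<close>.\<close>

lemma cyclic_partners:
  assumes p: "partner x s" "partner s t" "partner t x"
  shows False
proof -
  have h: "hits s" "hits t" "hits x" and e: "x \<sim> s" "s \<sim> t" "t \<sim> x"
    using p unfolding partner_def by blast+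
  obtain a b c where a: "s \<sim> a" "\<not> x \<sim> a" "a \<noteq> x" and b: "t \<sim> b" "\<not> s \<sim> b" "b \<noteq> s"
    and c: "x \<sim> c" "\<not> t \<sim> c" "c \<noteq> t"
    using partner_pendant p by metis
  have nta: "\<not> t \<sim> a" using hits_adj[OF h(3), of s t a] a e by (metis adj_irrefl)
  have nxb: "\<not> x \<sim> b" using hits_adj[OF h(1), of t x b] b e by (metis adj_irrefl)
  have nsc: "\<not> s \<sim> c" using hits_adj[OF h(2), of x s c] c e by (metis adj_irrefl)
  have ne: "a \<noteq> t" "b \<noteq> x" "c \<noteq> s" using a b c e adj_sym by blast+
  have "\<not> a \<sim> b" "\<not> b \<sim> c" "\<not> c \<sim> a"
    using square[of s a b t] square[of t b c x] square[of x c a s] a b c e nta nxb nsc ne adj_sym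
    by blast+
  then show False
    by (intro no_F2[of x s t c a b]) (use a b c e nta nxb nsc in \<open>simp_all add: adj_sym\<close>)
qed

lemma good_vertex:
  assumes ex: "triangle T0"
  shows "\<exists>c. good c"
proof (rule ccontr)
  assume no: "\<not> ?thesis"
  have nxt: "\<exists>s. partner x s" if "hits x" for x
    using obtain_partner[OF ex that] no by blast
  have h: "hits s" "x \<sim> s" if "partner x s" for x s using that unfolding partner_def by blast+
  obtain x where x: "hits x" using triangles_common_vertex by blast
  obtain s where s: "partner x s" using nxt[OF x] by blast
  obtain t where t: "partner s t" using nxt h[OF s] by blast
  obtain y where y: "partner t y" using nxt h[OF t] by blast
  have hs: "hits s" "hits t" "hits y" using h s t y by blast+
  have ne: "t \<noteq> x" "y \<noteq> s" using mutual_partners[OF ex] x hs s t y by blast+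
  have "x \<noteq> s" "s \<noteq> t" "t \<noteq> y" using h s t y by fastforce+
  moreover obtain a b where "T0 = {x, a, b}"
    using triangle_others[OF ex] x ex unfolding hits_def by metis
  moreover have "x \<in> T0" "s \<in> T0" "t \<in> T0" "y \<in> T0" using x hs ex unfolding hits_def by blast+
  \<comment> \<open>All of \<open>x\<close>, \<open>s\<close>, \<open>t\<close>, \<open>y\<close>
    lie in the three-element set \<open>T0\<close>, of which \<open>x\<close>, \<open>s\<close>,
    \<open>t\<close> are distinct.\<close>
  ultimately have "y = x" using ne by auto
  then show False using cyclic_partners s t y by blast
qed

subsection \<open>The partition given by a good vertex\<close>

definition inside :: "'a set \<Rightarrow> ('a \<times> 'a) set" where
  "inside W = {(x, y). x \<sim> y \<and> x \<in> W \<and> y \<in> W}"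

lemma sym_inside: "sym (inside W)"
  unfolding sym_def inside_def using adj_sym by blast

text \<open>In a shortest odd closed walk, a repeated vertex or a chord would split off a shorter
  odd closed walk. It is therefore an induced cycle: a triangle in \<open>W\<close>, or one
  forbidden by chordality.\<close>

lemma no_odd_closed_walk:
  assumes W: "\<And>T. triangle T \<Longrightarrow> \<not> T \<subseteq> W" and n: "odd n"
  shows "(x, x) \<notin> inside W ^^ n"
proof
  assume "(x, x) \<in> inside W ^^ n"
  with n have ex: "\<exists>n. odd n \<and> (\<exists>x. (x, x) \<in> inside W ^^ n)" by blast
  define m where "m = (LEAST n. odd n \<and> (\<exists>x. (x, x) \<in> inside W ^^ n))"
  from LeastI_ex[OF ex] obtain x where m: "odd m" "(x, x) \<in> inside W ^^ m"
    unfolding m_def by blast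
  have least: False if "odd k" "k < m" "(y, y) \<in> inside W ^^ k" for k y
    using not_less_Least that unfolding m_def by blast
  obtain p where p: "p 0 = x" "p m = x" "\<forall>i<m. (p i, p (Suc i)) \<in> inside W"
    using m(2) unfolding relpow_fun_conv by blast
  have inW: "p i \<in> W" if "i < m" for i using p(3) that unfolding inside_def by blast
  have forth: "(p i, p j) \<in> inside W ^^ (j - i)" if "i \<le> j" "j \<le> m" for i j
    using walk_segment[OF p(3)] that by blast
  \<comment> \<open>The complementary arc, passing through \<open>p m = p 0\<close>.\<close>
  have round: "(p j, p i) \<in> inside W ^^ (m - j + i)" if "i \<le> j" "j \<le> m" for i j
    using relpow_trans[of "p j" "p m" "m - j" "inside W" "p i" i] forth[of j m] forth[of 0 i] that p
    by simp
  have inj: "p i \<noteq> p j" if ij: "i < j" "j < m" for i j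
  proof
    assume "p i = p j"
    then have "(p i, p i) \<in> inside W ^^ (j - i)" "(p i, p i) \<in> inside W ^^ (m - j + i)"
      using forth[of i j] round[of i j] ij by auto
    moreover have "odd (j - i) \<or> odd (m - j + i)" using m(1) ij by presburger
    ultimately show False using least[of "j - i"] least[of "m - j + i"] ij by fastforce
  qed
  have chord: "j = Suc i \<or> i = 0 \<and> Suc j = m" if ij: "i < j" "j < m" "p i \<sim> p j" for i j
  proof (rule ccontr)
    assume n: "\<not> ?thesis"
    have e: "(p i, p j) \<in> inside W" "(p j, p i) \<in> inside W"
      using ij inW adj_sym unfolding inside_def by auto
    then have "(p i, p i) \<in> inside W ^^ Suc (j - i)" "(p j, p j) \<in> inside W ^^ Suc (m - j + i)"
      using forth[of i j] round[of i j] ij by auto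
    moreover have "odd (Suc (j - i)) \<or> odd (Suc (m - j + i))" using m(1) ij by presburger
    moreover have "Suc (j - i) < m" "Suc (m - j + i) < m" using ij n by linarith+
    ultimately show False using least by blast
  qed
  have step: "p i \<sim> p (Suc i)" if "i < m" for i using p(3) that unfolding inside_def by blast
  have "m \<noteq> 1" using m(2) by (auto simp: inside_def)
  then consider "m = 3" | "4 \<le> m" using m(1) by (cases "m \<le> 3") (auto simp: le_Suc_eq numeral_3_eq_3)
  then show False
  proof cases
    case 1
    then have "p 0 \<sim> p 1" "p 1 \<sim> p 2" "p 2 \<sim> p 0"
      using step[of 0] step[of 1] step[of 2] p by (auto simp: numeral_2_eq_2 numeral_3_eq_3)
    moreover have "{p 0, p 1, p 2} \<subseteq> W" using inW 1 by auto
    ultimately show False using W[OF triangleI[of "p 0" "p 1" "p 2"]] adj_sym by blast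
  next
    case 2
    have "inj_on p {0..<m}"
      using inj by (auto simp: inj_on_def) (metis nat_neq_iff)
    moreover have "p 0 \<sim> p (m - 1)" using step[of "m - 1"] p 2 adj_sym by auto
    ultimately show False
      by (intro no_cycle[OF 2, of p]) (use chord step in auto)
  qed
qed

text \<open>A shortest such walk is an induced path whose inner vertices are all adjacent to
  \<open>c\<close>. Lengths 1 and 3 contradict \<open>good\<close>; from 5 on, the path and
  \<open>c\<close> form a \<open>fan\<close>.\<close>

lemma no_odd_walk_between_nonneighbours:
  assumes c: "good c" and n: "odd n"
    and xy: "x \<noteq> c" "\<not> c \<sim> x" "y \<noteq> c" "\<not> c \<sim> y"
  shows "(x, y) \<notin> inside (- {c}) ^^ n"
proof
  let ?R = "inside (- {c})"
  define S where "S = {v. v \<noteq> c \<and> \<not> c \<sim> v}"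
  assume "(x, y) \<in> ?R ^^ n"
  with n xy have ex: "\<exists>n. odd n \<and> (\<exists>x\<in>S. \<exists>y\<in>S. (x, y) \<in> ?R ^^ n)"
    unfolding S_def by blast
  define m where "m = (LEAST n. odd n \<and> (\<exists>x\<in>S. \<exists>y\<in>S. (x, y) \<in> ?R ^^ n))"
  from LeastI_ex[OF ex] obtain x y where m: "odd m" "x \<in> S" "y \<in> S" "(x, y) \<in> ?R ^^ m"
    unfolding m_def by blast
  have least: False if "odd k" "k < m" "x \<in> S" "y \<in> S" "(x, y) \<in> ?R ^^ k" for k x y
    using not_less_Least that unfolding m_def by blast
  have closed: "even k" if "(z, z) \<in> ?R ^^ k" for k z
    using no_odd_closed_walk[of "- {c}" k z] c that unfolding good_def hits_def by blast
  obtain p where p: "p 0 = x" "p m = y" "\<forall>i<m. (p i, p (Suc i)) \<in> ?R"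
    using m(4) unfolding relpow_fun_conv by blast
  have step: "p i \<sim> p (Suc i)" if "i < m" for i using p(3) that unfolding inside_def by blast
  have nc: "p i \<noteq> c" if "i \<le> m" for i
    using p m that unfolding inside_def S_def by (cases "i = m") auto
  have seg: "(p i, p j) \<in> ?R ^^ (j - i)" if "i \<le> j" "j \<le> m" for i j
    using walk_segment[OF p(3)] that by blast
  have chord: "j = Suc i" if ij: "i < j" "j \<le> m" "p i \<sim> p j" for i j
  proof (rule ccontr)
    assume n: "\<not> ?thesis"
    have e: "(p i, p j) \<in> ?R" "(p j, p i) \<in> ?R"
      using ij nc adj_sym unfolding inside_def by auto
    \<comment> \<open>The chord closes a walk in the graph without \<open>c\<close>, which must be
      even; so the chord replaces a segment of odd length and the shortcut keeps the parity.\<close>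
    have "(p i, p i) \<in> ?R ^^ Suc (j - i)" using seg[of i j] e ij by auto
    then have "even (Suc (j - i))" using closed by blast
    then have "odd (j - i)" by simp
    then have "odd (Suc i + (m - j))" using m(1) ij by presburger
    moreover have "(p 0, p j) \<in> ?R ^^ Suc i" using seg[of 0 i] e ij by auto
    then have "(x, y) \<in> ?R ^^ (Suc i + (m - j))"
      using relpow_trans seg[of j m] ij p by (metis order_refl)
    moreover have "Suc i + (m - j) < m" using ij n by linarith
    ultimately show False using least[OF _ _ m(2,3)] by blast
  qed
  have inner: "c \<sim> p i" if i: "0 < i" "i < m" for i
  proof (rule ccontr)
    assume "\<not> c \<sim> p i"
    then have "p i \<in> S" using nc i unfolding S_def by auto
    moreover have "(x, p i) \<in> ?R ^^ i" "(p i, y) \<in> ?R ^^ (m - i)"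
      using seg[of 0 i] seg[of i m] p i by auto
    moreover have "odd i \<or> odd (m - i)" using m(1) i by presburger
    \<comment> \<open>A non-neighbour of \<open>c\<close> inside the walk splits it into two shorter
      walks, one of them odd.\<close>
    ultimately show False
      using least[of i x "p i"] least[of "m - i" "p i" y] m i by fastforce
  qed
  have ends: "\<not> c \<sim> p 0" "\<not> c \<sim> p m" using m p unfolding S_def by auto
  have edges: "u = c \<or> v = c \<or> c \<sim> u \<or> c \<sim> v" if "u \<sim> v" for u v
    using c that unfolding good_def by blast
  have bulls: "p = c \<or> s = c \<or> c \<sim> p \<or> c \<sim> s"
    if "p \<sim> q" "q \<sim> r" "r \<sim> s" "c \<sim> q" "c \<sim> r" "\<not> p \<sim> s" for p q r s
    using c that unfolding good_def by blast
  have "m \<noteq> 1"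
  proof
    assume m1: "m = 1"
    then have "p 0 \<sim> p 1" using step[of 0] by simp
    from edges[OF this] show False using nc[of 0] nc[of 1] ends m1 by simp
  qed
  moreover have "m \<noteq> 3"
  proof
    assume m3: "m = 3"
    then have "p 0 \<sim> p 1" "p 1 \<sim> p 2" "p 2 \<sim> p 3" "c \<sim> p 1" "c \<sim> p 2"
      using step[of 0] step[of 1] step[of 2] inner[of 1] inner[of 2] by (simp_all add: numeral_2_eq_2 numeral_3_eq_3)
    moreover have "\<not> p 0 \<sim> p 3" using chord[of 0 3] m3 by auto
    ultimately show False using bulls[of "p 0" "p 1" "p 2" "p 3"] nc[of 0] nc[of 3] ends m3 by simp
  qed
  ultimately have m5: "5 \<le> m" using m(1) by presburger
  define f where "f i = (if i = Suc m then c else p i)" for i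
  have mem: "fan m \<in> forbidden" using m(1) m5 forbidden_members by blast
  have verts: "pverts (fan m) = {0..Suc m}" by (simp add: fan_def)
  have arcs: "(i, j) \<in> parcs (fan m) \<longleftrightarrow>
      (j = Suc i \<and> i < m) \<or> (i = Suc j \<and> j < m) \<or>
      (i = Suc m \<and> 0 < j \<and> j < m) \<or> (j = Suc m \<and> 0 < i \<and> i < m)" for i j
    using m5 by (auto simp: fan_def)
  have nbr: "\<exists>z\<in>pverts (fan m). (i, z) \<in> parcs (fan m)" if "i \<in> pverts (fan m)" for i
  proof -
    define z where "z = (if i = 0 \<or> i = Suc m then 1 else i - 1)"
    have "(i, z) \<in> parcs (fan m)" "z \<le> Suc m"
      unfolding arcs z_def using that m5 verts by auto
    then show ?thesis unfolding verts by (intro bexI[of _ z]) simp_all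
  qed
  \<comment> \<open>The distinguishing vertex is the successor of \<open>j\<close>, the apex, or
    path vertex 1 or 4; the bound \<open>m5\<close> makes 4 an inner vertex of the path.\<close>
  have twin: "\<exists>z\<in>pverts (fan m). (i, z) \<in> parcs (fan m) \<longleftrightarrow> (j, z) \<notin> parcs (fan m)"
    if "i \<in> pverts (fan m)" "j \<in> pverts (fan m)" "i < j" for i j
  proof -
    have "j \<le> Suc m" using that verts by simp
    then consider "j < m" | "j = m" "i = 0" | "j = m" "0 < i" | "j = Suc m" "i \<le> 2" | "j = Suc m" "2 < i"
      by linarith
    then show ?thesis
    proof cases
      case 1
      then have "(i, Suc j) \<notin> parcs (fan m)" "(j, Suc j) \<in> parcs (fan m)" "Suc j \<le> Suc m"
        unfolding arcs using that(3) by linarith+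
      then show ?thesis unfolding verts by (intro bexI[of _ "Suc j"]) simp_all
    next
      case 2
      then have "(i, 1) \<in> parcs (fan m)" "(j, 1) \<notin> parcs (fan m)"
        unfolding arcs using m5 by linarith+
      then show ?thesis unfolding verts by (intro bexI[of _ 1]) simp_all
    next
      case 3
      then have "(i, Suc m) \<in> parcs (fan m)" "(j, Suc m) \<notin> parcs (fan m)"
        unfolding arcs using that(3) by linarith+
      then show ?thesis unfolding verts by (intro bexI[of _ "Suc m"]) simp_all
    next
      case 4
      then have "(i, 4) \<notin> parcs (fan m)" "(j, 4) \<in> parcs (fan m)"
        unfolding arcs using m5 by linarith+
      then show ?thesis unfolding verts using m5 by (intro bexI[of _ 4]) simp_all
    next
      case 5
      then have "(i, 1) \<notin> parcs (fan m)" "(j, 1) \<in> parcs (fan m)"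
        unfolding arcs using m5 that(3) by linarith+
      then show ?thesis unfolding verts by (intro bexI[of _ 1]) simp_all
    qed
  qed
  have adj: "f i \<sim> f j \<longleftrightarrow> (i, j) \<in> parcs (fan m)"
    if "i \<in> pverts (fan m)" "j \<in> pverts (fan m)" "i < j" for i j
  proof (cases "j = Suc m")
    case True
    have "c \<sim> p i \<longleftrightarrow> 0 < i \<and> i < m"
    proof (cases "i = 0 \<or> i = m")
      case True
      with ends show ?thesis by auto
    next
      case False
      with inner[of i] that True show ?thesis unfolding verts by simp
    qed
    moreover have "(i, j) \<in> parcs (fan m) \<longleftrightarrow> 0 < i \<and> i < m"
      unfolding arcs using True that(3) by linarith
    moreover have "f i = p i" "f j = c" using True that(3) by (simp_all add: f_def)
    ultimately show ?thesis by (simp add: adj_sym[of _ c])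
  next
    case False
    then have j: "j \<le> m" using that verts by simp
    have "(i, j) \<in> parcs (fan m) \<longleftrightarrow> j = Suc i" unfolding arcs using j that(3) by linarith
    moreover have "p i \<sim> p j \<longleftrightarrow> j = Suc i" using chord[of i j] step[of i] j that(3) by auto
    moreover have "f i = p i" "f j = p j" using j that(3) by (simp_all add: f_def)
    ultimately show ?thesis by simp
  qed
  show False
    by (rule no_forbidden[of "fan m" f]) (intro ballI impI mem nbr twin adj; assumption)+
qed

lemma admits_M1: "admits_partition M1 G"
proof (cases "\<exists>T. triangle T")
  case True
  then obtain c where c: "good c" using good_vertex by blast
  let ?S = "{v. v \<noteq> c \<and> \<not> c \<sim> v}"
  have no: "\<not> T \<subseteq> - {c}" if "triangle T" for T
    using c that unfolding good_def hits_def by blast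
  have "\<exists>A. ?S \<subseteq> A \<and> (\<forall>(x, y)\<in>inside (- {c}). x \<in> A \<longleftrightarrow> y \<notin> A)"
    by (rule two_colouring_extending[OF sym_inside no_odd_closed_walk[OF no]])
      (use no_odd_walk_between_nonneighbours[OF c] in auto)
  then obtain A where A: "?S \<subseteq> A" "\<forall>(x, y)\<in>inside (- {c}). x \<in> A \<longleftrightarrow> y \<notin> A" by blast
  have "c \<in> pverts G"
    using True c adj_verts unfolding good_def hits_def triangle_def by blast
  then show ?thesis
    unfolding admits_partition_M1_iff[OF pair_graph_axioms]
    \<comment> \<open>\<open>V2\<close> is the single vertex \<open>c\<close>. Its non-neighbours
      all lie in \<open>A\<close>, so it is joined to the whole other colour class
      \<open>V3\<close>.\<close>
    by (intro exI[of _ "(A - {c}) \<inter> pverts G"] exI[of _ "{c}"] exI[of _ "pverts G - {c} - A"])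
      (use A in \<open>auto simp: independent_set_def inside_def\<close>)
next
  case False
  then have no: "\<not> T \<subseteq> UNIV" if "triangle T" for T using that by blast
  \<comment> \<open>Without triangles the graph is bipartite, and \<open>V3\<close> can be
    empty.\<close>
  have "\<exists>A. {} \<subseteq> A \<and> (\<forall>(x, y)\<in>inside UNIV. x \<in> A \<longleftrightarrow> y \<notin> A)"
    by (rule two_colouring_extending[OF sym_inside no_odd_closed_walk[OF no]]) auto
  then obtain A where A: "\<forall>(x, y)\<in>inside UNIV. x \<in> A \<longleftrightarrow> y \<notin> A" by blast
  then show ?thesis
    unfolding admits_partition_M1_iff[OF pair_graph_axioms]
    by (intro exI[of _ "A \<inter> pverts G"] exI[of _ "pverts G - A"] exI[of _ "{}"])
      (auto simp: independent_set_def inside_def)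
qed

end

subsection \<open>The forbidden graphs have no partition\<close>

text \<open>The parts are pulled back along the embedding.\<close>

lemma admits_partition_M1_induced:
  assumes G: "pair_graph G" and F: "pair_graph F"
    and "contains_induced G F" "admits_partition M1 G"
  shows "admits_partition M1 F"
proof -
  obtain f where f: "f ` pverts F \<subseteq> pverts G"
    "\<forall>x\<in>pverts F. \<forall>y\<in>pverts F. (f x, f y) \<in> parcs G \<longleftrightarrow> (x, y) \<in> parcs F"
    using assms(3) unfolding contains_induced_iff[OF G F] by blast
  obtain V1 V2 V3 where V: "V1 \<union> V2 \<union> V3 = pverts G"
    "V1 \<inter> V2 = {}" "V1 \<inter> V3 = {}" "V2 \<inter> V3 = {}"
    "independent_set G V1" "independent_set G V2" "independent_set G V3"
    "\<forall>x\<in>V2. \<forall>y\<in>V3. (x, y) \<in> parcs G"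
    using assms(4) unfolding admits_partition_M1_iff[OF G] by blast
  let ?U = "\<lambda>V. {x \<in> pverts F. f x \<in> V}"
  have "independent_set F (?U V)" if "independent_set G V" for V
    using that f unfolding independent_set_def by blast
  moreover have "?U V1 \<union> ?U V2 \<union> ?U V3 = pverts F" using V f by blast
  moreover have "\<forall>x\<in>?U V2. \<forall>y\<in>?U V3. (x, y) \<in> parcs F" using V f by blast
  ultimately show ?thesis
    unfolding admits_partition_M1_iff[OF F]
    by (intro exI[of _ "?U V1"] exI[of _ "?U V2"] exI[of _ "?U V3"]) (use V in auto)
qed

text \<open>For a concrete graph these conditions unfold to finitely many propositional clauses
  about membership in the parts, which \<open>sat\<close> can refute.\<close>

lemma M1_partition_constraints:
  fixes F :: "'a::linorder pair_pre_digraph"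
  assumes F: "pair_graph F" and "admits_partition M1 F"
  obtains V1 V2 V3 where "\<forall>x\<in>pverts F. x \<in> V1 \<or> x \<in> V2 \<or> x \<in> V3"
    and "\<forall>x\<in>pverts F. \<forall>y\<in>pverts F. x < y \<longrightarrow>
      (if (x, y) \<in> parcs F
       then (x \<notin> V1 \<or> y \<notin> V1) \<and> (x \<notin> V2 \<or> y \<notin> V2) \<and> (x \<notin> V3 \<or> y \<notin> V3)
       else (x \<notin> V2 \<or> y \<notin> V3) \<and> (x \<notin> V3 \<or> y \<notin> V2))"
proof -
  interpret F: sgraph F using F by (rule sgraph.intro)
  obtain V1 V2 V3 where V: "V1 \<union> V2 \<union> V3 = pverts F"
    "independent_set F V1" "independent_set F V2" "independent_set F V3"
    "\<forall>x\<in>V2. \<forall>y\<in>V3. (x, y) \<in> parcs F"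
    using assms(2) unfolding admits_partition_M1_iff[OF F] by blast
  have "\<forall>x\<in>V3. \<forall>y\<in>V2. (x, y) \<in> parcs F" using V(5) F.adj_sym by blast
  show thesis
  proof (rule that[of V1 V2 V3])
    show "\<forall>x\<in>pverts F. x \<in> V1 \<or> x \<in> V2 \<or> x \<in> V3" using V(1) by blast
  qed (use V(2-5) \<open>\<forall>x\<in>V3. \<forall>y\<in>V2. _\<close> in \<open>auto simp: independent_set_def\<close>)
qed

section \<open>Propositional refutations for the seven single graphs\<close>

lemma F1_no_M1_partition: "\<not> admits_partition M1 F1"
proof
  assume "admits_partition M1 F1"
  then show False
    by (rule M1_partition_constraints[OF pair_graph_forbidden[OF forbidden_members(1)]])
      (simp add: F1_def small_intervals, sat)
qed

lemma F2_no_M1_partition: "\<not> admits_partition M1 F2"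
proof
  assume "admits_partition M1 F2"
  then show False
    by (rule M1_partition_constraints[OF pair_graph_forbidden[OF forbidden_members(2)]])
      (simp add: F2_def small_intervals, sat)
qed

lemma F3_no_M1_partition: "\<not> admits_partition M1 F3"
proof
  assume "admits_partition M1 F3"
  then show False
    by (rule M1_partition_constraints[OF pair_graph_forbidden[OF forbidden_members(3)]])
      (simp add: F3_def small_intervals, sat)
qed

lemma F4_no_M1_partition: "\<not> admits_partition M1 F4"
proof
  assume "admits_partition M1 F4"
  then show False
    by (rule M1_partition_constraints[OF pair_graph_forbidden[OF forbidden_members(4)]])
      (simp add: F4_def small_intervals, sat)
qed

lemma F5_no_M1_partition: "\<not> admits_partition M1 F5"
proof
  assume "admits_partition M1 F5"
  then show False
    by (rule M1_partition_constraints[OF pair_graph_forbidden[OF forbidden_members(5)]])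
      (simp add: F5_def small_intervals, sat)
qed

lemma F6_no_M1_partition: "\<not> admits_partition M1 F6"
proof
  assume "admits_partition M1 F6"
  then show False
    by (rule M1_partition_constraints[OF pair_graph_forbidden[OF forbidden_members(6)]])
      (simp add: F6_def small_intervals, sat)
qed

lemma F7_no_M1_partition: "\<not> admits_partition M1 F7"
proof
  assume "admits_partition M1 F7"
  then show False
    by (rule M1_partition_constraints[OF pair_graph_forbidden[OF forbidden_members(7)]])
      (simp add: F7_def small_intervals, sat)
qed

text \<open>With the apex in \<open>V2\<close> or \<open>V3\<close>, the inner path alternates
  between the opposite part and \<open>V1\<close>. The ends of the path force odd positions into the
  opposite part, and the odd length makes this fail at \<open>k\<close>.\<close>

lemma fan_no_M1_partition:
  assumes "odd k" "5 \<le> k"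
  shows "\<not> admits_partition M1 (fan k)"
proof
  assume M: "admits_partition M1 (fan k)"
  have F: "pair_graph (fan k)" using assms forbidden_members pair_graph_forbidden by blast
  then interpret F: sgraph "fan k" by (rule sgraph.intro)
  let ?E = "parcs (fan k)"
  obtain V1 V2 V3 where V: "V1 \<union> V2 \<union> V3 = {0..Suc k}"
    "independent_set (fan k) V1" "independent_set (fan k) V2" "independent_set (fan k) V3"
    "\<forall>x\<in>V2. \<forall>y\<in>V3. (x, y) \<in> ?E"
    using M unfolding admits_partition_M1_iff[OF F] by (auto simp: fan_def)
  have arcs: "(i, j) \<in> ?E \<longleftrightarrow>
      (j = Suc i \<and> i < k) \<or> (i = Suc j \<and> j < k) \<or>
      (i = Suc k \<and> 0 < j \<and> j < k) \<or> (j = Suc k \<and> 0 < i \<and> i < k)" for i j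
    using assms by (auto simp: fan_def)
  \<comment> \<open>\<open>A\<close> is whichever of \<open>V2\<close>, \<open>V3\<close> contains
    the apex, \<open>B\<close> the other.\<close>
  have wlog: False if A: "A \<union> B = V2 \<union> V3" "independent_set (fan k) A" "independent_set (fan k) B"
    "\<forall>x\<in>A. \<forall>y\<in>B. (x, y) \<in> ?E \<and> (y, x) \<in> ?E" and apex: "Suc k \<in> A" for A B
  proof -
    have in3: "i \<in> V1 \<or> i \<in> A \<or> i \<in> B" if "i \<le> Suc k" for i
    proof -
      have "i \<in> V1 \<union> V2 \<union> V3" unfolding V(1) using that by simp
      then show ?thesis using A(1) by blast
    qed
    have nadj: "\<not> (x \<in> W \<and> y \<in> W)" if "(x, y) \<in> ?E" "W = V1 \<or> W = A \<or> W = B" for x y W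
      using V(2) A that unfolding independent_set_def by blast
    have inner: "i \<in> V1 \<or> i \<in> B" if "0 < i" "i < k" for i
    proof -
      have "(i, Suc k) \<in> ?E" unfolding arcs using that by simp
      then show ?thesis using in3[of i] nadj[of i "Suc k" A] apex that by auto
    qed
    have ends: "i \<in> V1 \<or> i \<in> A" if "i = 0 \<or> i = k" for i
    proof -
      have "(Suc k, i) \<notin> ?E" unfolding arcs using that assms by linarith
      then show ?thesis using in3[of i] A(4) apex that by auto
    qed
    have path: "i \<in> W \<Longrightarrow> Suc i \<notin> W" if "i < k" "W = V1 \<or> W = A \<or> W = B" for i W
    proof -
      have "(i, Suc i) \<in> ?E" unfolding arcs using that by simp
      then show "i \<in> W \<Longrightarrow> Suc i \<notin> W" using nadj[of i "Suc i" W] that by blast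
    qed
    have far: "\<not> (i \<in> A \<and> j \<in> B)" if "(i, j) \<notin> ?E" for i j using A(4) that by blast
    \<comment> \<open>Otherwise 1 is in \<open>V1\<close> and 2 in \<open>B\<close>; then 0 cannot
      be in \<open>V1\<close> next to 1, nor in \<open>A\<close>, being non-adjacent to 2.\<close>
    have "1 \<in> B"
    proof (rule ccontr)
      assume "1 \<notin> B"
      then have "1 \<in> V1" using inner[of 1] assms by auto
      moreover have "2 \<in> B" using inner[of 2] path[of 1 V1] \<open>1 \<in> V1\<close> assms by (auto simp: numeral_2_eq_2)
      moreover have "(0, 2) \<notin> ?E" unfolding arcs using assms by linarith
      ultimately have "0 \<in> V1" using far[of 0 2] ends[of 0] by blast
      then show False using path[of 0 V1] \<open>1 \<in> V1\<close> assms by auto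
    qed
    have alt: "if odd i then i \<in> B else i \<in> V1" if "0 < i" "i < k" for i
      using that
    proof (induction i)
      case (Suc i)
      show ?case
      proof (cases "i = 0")
        case True
        with \<open>1 \<in> B\<close> show ?thesis by simp
      next
        case False
        then have "if odd i then i \<in> B else i \<in> V1" using Suc by simp
        then show ?thesis
          using inner[of "Suc i"] path[of i B] path[of i V1] Suc.prems by (auto split: if_splits)
      qed
    qed simp
    \<comment> \<open>As \<open>k\<close> is odd, the same obstruction that was used at 0 now arises
      at the other end.\<close>
    have "k - 1 \<in> V1" "k - 2 \<in> B" using alt[of "k - 1"] alt[of "k - 2"] assms by auto
    moreover have "(k, k - 2) \<notin> ?E" unfolding arcs using assms by linarith
    ultimately have "k \<in> V1" using far[of k "k - 2"] ends[of k] by blast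
    then show False using path[of "k - 1" V1] \<open>k - 1 \<in> V1\<close> assms by auto
  qed
  have "Suc k \<in> V1 \<union> V2 \<union> V3" unfolding V(1) by simp
  then consider "Suc k \<in> V1" | "Suc k \<in> V2" | "Suc k \<in> V3" by blast
  then show False
  proof cases
    \<comment> \<open>Path vertices 1 to 4 alternate between \<open>V2\<close> and
      \<open>V3\<close>, so 1 and 4 lie in opposite parts without being adjacent.\<close>
    case 1
    have "i \<in> V2 \<or> i \<in> V3" if "0 < i" "i < k" for i
    proof -
      have "i \<in> V1 \<union> V2 \<union> V3" unfolding V(1) using that by simp
      moreover have "(i, Suc k) \<in> ?E" unfolding arcs using that by simp
      ultimately show ?thesis using 1 V(2) unfolding independent_set_def by blast
    qed
    from this[of 1] this[of 2] this[of 3] this[of 4] have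
      "1 \<in> V2 \<or> 1 \<in> V3" "2 \<in> V2 \<or> 2 \<in> V3" "3 \<in> V2 \<or> 3 \<in> V3" "4 \<in> V2 \<or> 4 \<in> V3"
      using assms by auto
    moreover have "(1, 2) \<in> ?E" "(2, 3) \<in> ?E" "(3, 4) \<in> ?E" "(1, 4) \<notin> ?E" "(4, 1) \<notin> ?E"
      unfolding arcs using assms by simp_all
    ultimately show False using V(3-5) unfolding independent_set_def by blast
  next
    case 2
    show False by (rule wlog[of V2 V3]) (use 2 V(3-5) F.adj_sym in blast)+
  next
    case 3
    show False by (rule wlog[of V3 V2]) (use 3 V(3-5) F.adj_sym in blast)+
  qed
qed

theorem theorem1:
  fixes G :: "'a pair_pre_digraph"
  assumes "pair_graph G"
    and "chordal G"
  shows "admits_partition M1 G \<longleftrightarrow> free_of forbidden G"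
proof
  assume M: "admits_partition M1 G"
  have "\<not> admits_partition M1 F" if "F \<in> forbidden" for F
    using that F1_no_M1_partition F2_no_M1_partition F3_no_M1_partition F4_no_M1_partition
      F5_no_M1_partition F6_no_M1_partition F7_no_M1_partition fan_no_M1_partition
    unfolding forbidden_def by blast
  then show "free_of forbidden G"
    using admits_partition_M1_induced[OF assms(1) pair_graph_forbidden _ M]
    unfolding free_of_def by blast
next
  assume "free_of forbidden G"
  then interpret chordal_forbidden_free G
    using assms by (simp add: chordal_forbidden_free_def chordal_forbidden_free_axioms_def sgraph_def)
  show "admits_partition M1 G" by (rule admits_M1)
qed

end
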